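(* Let $C$ be a unique factorization category. Then the nerve of $C$ deformation retracts to a simplicial set whose $n$-simplices are all degenerate for $n>1$; that is, there is a simplicial subset $Y$ of the nerve $\mathcal{N}(C)$ such that all $n$-simplices of $Y$ are degenerate for $n>1$ and the geometric realization $|Y|$ is a deformation retract of $|\mathcal{N}(C)|$.
   Context: A finite directed category is a category with finitely many objects and finitely many morphisms such that $\mathrm{Hom}(a,a)=\{\mathrm{id}_a\}$ for every object $a$, and for all objects $a\neq b$, if $\mathrm{Hom}(a,b)\neq\emptyset$ then $\mathrm{Hom}(b,a)=\emptyset$. A morphism $f\colon A\to B$ is indecomposable if there are no morphisms $h\neq\mathrm{id}_B$ and $g\neq\mathrm{id}_A$ with $f=h\circ g$. A unique factorization category is a finite directed category in which every non-identity morphism can be written in a unique way as a composition of non-identity indecomposable morphisms. *)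

theory Defs
  imports "HOL-Analysis.Analysis" "HOL-Homology.Simplices"
begin

section \<open>Unique factorization categories\<close>

record ('o, 'm) category =
  Obj :: "'o set"
  Mor :: "'m set"
  Dom :: "'m \<Rightarrow> 'o"
  Cod :: "'m \<Rightarrow> 'o"
  Ident :: "'o \<Rightarrow> 'm"
  Comp :: "'m \<Rightarrow> 'm \<Rightarrow> 'm"  \<comment> \<open>\<open>Comp C h g\<close> is ``h after g''\<close>

locale category =
  fixes C :: "('o, 'm) category"
  assumes dom_in_Obj: "f \<in> Mor C \<Longrightarrow> Dom C f \<in> Obj C"
    and cod_in_Obj: "f \<in> Mor C \<Longrightarrow> Cod C f \<in> Obj C"
    and ident_in_Mor: "a \<in> Obj C \<Longrightarrow> Ident C a \<in> Mor C"
    and dom_ident: "a \<in> Obj C \<Longrightarrow> Dom C (Ident C a) = a"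
    and cod_ident: "a \<in> Obj C \<Longrightarrow> Cod C (Ident C a) = a"
    and comp_in_Mor:
      "\<lbrakk>g \<in> Mor C; h \<in> Mor C; Cod C g = Dom C h\<rbrakk> \<Longrightarrow> Comp C h g \<in> Mor C"
    and dom_comp:
      "\<lbrakk>g \<in> Mor C; h \<in> Mor C; Cod C g = Dom C h\<rbrakk> \<Longrightarrow> Dom C (Comp C h g) = Dom C g"
    and cod_comp:
      "\<lbrakk>g \<in> Mor C; h \<in> Mor C; Cod C g = Dom C h\<rbrakk> \<Longrightarrow> Cod C (Comp C h g) = Cod C h"
    and comp_ident_right: "f \<in> Mor C \<Longrightarrow> Comp C f (Ident C (Dom C f)) = f"
    and comp_ident_left: "f \<in> Mor C \<Longrightarrow> Comp C (Ident C (Cod C f)) f = f"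
    and comp_assoc:
      "\<lbrakk>f \<in> Mor C; g \<in> Mor C; h \<in> Mor C; Cod C f = Dom C g; Cod C g = Dom C h\<rbrakk>
        \<Longrightarrow> Comp C h (Comp C g f) = Comp C (Comp C h g) f"

definition hom_set :: "('o, 'm) category \<Rightarrow> 'o \<Rightarrow> 'o \<Rightarrow> 'm set" where
  "hom_set C a b = {f \<in> Mor C. Dom C f = a \<and> Cod C f = b}"

locale finite_directed_category = category C for C :: "('o, 'm) category" +
  assumes finite_Obj: "finite (Obj C)"
    and finite_Mor: "finite (Mor C)"
    and endo_trivial: "a \<in> Obj C \<Longrightarrow> hom_set C a a = {Ident C a}"
    and directed:
      "\<lbrakk>a \<in> Obj C; b \<in> Obj C; a \<noteq> b; hom_set C a b \<noteq> {}\<rbrakk> \<Longrightarrow> hom_set C b a = {}"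

definition non_identity :: "('o, 'm) category \<Rightarrow> 'm \<Rightarrow> bool" where
  "non_identity C f \<longleftrightarrow> f \<in> Mor C \<and> f \<notin> Ident C ` Obj C"

definition indecomposable :: "('o, 'm) category \<Rightarrow> 'm \<Rightarrow> bool" where
  "indecomposable C f \<longleftrightarrow> f \<in> Mor C \<and>
     \<not> (\<exists>g\<in>Mor C. \<exists>h\<in>Mor C. Cod C g = Dom C h \<and>
          g \<noteq> Ident C (Dom C f) \<and> h \<noteq> Ident C (Cod C f) \<and> f = Comp C h g)"

text \<open>
  A string of morphisms is listed in the order in which they are applied, so that
  \<open>[f\<^sub>1, \<dots>, f\<^sub>k]\<close> has composite \<open>f\<^sub>k \<circ> \<dots> \<circ> f\<^sub>1\<close>.
\<close>

definition composable :: "('o, 'm) category \<Rightarrow> 'm list \<Rightarrow> bool" where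
  "composable C fs \<longleftrightarrow>
     fs \<noteq> [] \<and> set fs \<subseteq> Mor C \<and> successively (\<lambda>g h. Cod C g = Dom C h) fs"

fun composite :: "('o, 'm) category \<Rightarrow> 'm list \<Rightarrow> 'm" where
  "composite C [] = undefined"
| "composite C [f] = f"
| "composite C (f # g # fs) = Comp C (composite C (g # fs)) f"

definition factorization :: "('o, 'm) category \<Rightarrow> 'm \<Rightarrow> 'm list \<Rightarrow> bool" where
  "factorization C f fs \<longleftrightarrow> composable C fs \<and>
     (\<forall>g\<in>set fs. non_identity C g \<and> indecomposable C g) \<and> composite C fs = f"

locale unique_factorization_category = finite_directed_category C
  for C :: "('o, 'm) category" +
  assumes unique_factorization: "non_identity C f \<Longrightarrow> \<exists>!fs. factorization C f fs"


section \<open>Simplicial sets\<close>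

definition monotone_maps :: "nat \<Rightarrow> nat \<Rightarrow> (nat \<Rightarrow> nat) set" where
  "monotone_maps m n = {\<theta> \<in> {..m} \<rightarrow>\<^sub>E {..n}. mono_on {..m} \<theta>}"

text \<open>For \<open>\<theta> : [m] \<rightarrow> [n]\<close> and \<open>x \<in> X\<^sub>n\<close>, \<open>act X m n \<theta> x\<close> is \<open>\<theta>\<^sup>* x \<in> X\<^sub>m\<close>.\<close>

record 'x sset =
  simplices :: "nat \<Rightarrow> 'x set"
  act :: "nat \<Rightarrow> nat \<Rightarrow> (nat \<Rightarrow> nat) \<Rightarrow> 'x \<Rightarrow> 'x"

locale simplicial_set =
  fixes X :: "'x sset"
  assumes act_in:
      "\<lbrakk>\<theta> \<in> monotone_maps m n; x \<in> simplices X n\<rbrakk> \<Longrightarrow> act X m n \<theta> x \<in> simplices X m"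
    and act_id: "x \<in> simplices X n \<Longrightarrow> act X n n (restrict id {..n}) x = x"
    and act_comp:
      "\<lbrakk>\<phi> \<in> monotone_maps l m; \<theta> \<in> monotone_maps m n; x \<in> simplices X n\<rbrakk>
        \<Longrightarrow> act X l n (compose {..l} \<theta> \<phi>) x = act X l m \<phi> (act X m n \<theta> x)"

definition simplicial_subset :: "'x sset \<Rightarrow> 'x sset \<Rightarrow> bool" where
  "simplicial_subset Y X \<longleftrightarrow> simplicial_set Y \<and> (\<forall>n. simplices Y n \<subseteq> simplices X n) \<and>
     (\<forall>m n. \<forall>\<theta>\<in>monotone_maps m n. \<forall>x\<in>simplices Y n. act Y m n \<theta> x = act X m n \<theta> x)"

text \<open>The surjection \<open>[k + 1] \<rightarrow> [k]\<close> that hits \<open>i\<close> twice.\<close>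

definition codegeneracy :: "nat \<Rightarrow> nat \<Rightarrow> nat \<Rightarrow> nat" where
  "codegeneracy k i = (\<lambda>j\<in>{..Suc k}. if j \<le> i then j else j - 1)"

definition degenerate :: "'x sset \<Rightarrow> nat \<Rightarrow> 'x \<Rightarrow> bool" where
  "degenerate X n x \<longleftrightarrow>
     (\<exists>k i y. n = Suc k \<and> i \<le> k \<and> y \<in> simplices X k \<and> x = act X n k (codegeneracy k i) y)"


section \<open>The nerve\<close>

text \<open>The poset \<open>[n]\<close> as a category; the pair \<open>(i, j)\<close> is the unique morphism from \<open>i\<close> to \<open>j\<close>.\<close>

definition ordinal_category :: "nat \<Rightarrow> (nat, nat \<times> nat) category" where
  "ordinal_category n =
     \<lparr>Obj = {..n}, Mor = {(i, j). i \<le> j \<and> j \<le> n}, Dom = fst, Cod = snd,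
      Ident = (\<lambda>i. (i, i)), Comp = (\<lambda>h g. (fst g, snd h))\<rparr>"

text \<open>
  A functor is a pair of an object map and a morphism map, both extensional, so that equality of
  pairs is equality of functors.
\<close>

type_synonym ('o, 'm, 'p, 'n) cat_functor = "('o \<Rightarrow> 'p) \<times> ('m \<Rightarrow> 'n)"

definition functors ::
  "('o, 'm) category \<Rightarrow> ('p, 'n) category \<Rightarrow> ('o, 'm, 'p, 'n) cat_functor set" where
  "functors A B = {(F\<^sub>0, F\<^sub>1). F\<^sub>0 \<in> Obj A \<rightarrow>\<^sub>E Obj B \<and> F\<^sub>1 \<in> Mor A \<rightarrow>\<^sub>E Mor B \<and>
     (\<forall>f\<in>Mor A. Dom B (F\<^sub>1 f) = F\<^sub>0 (Dom A f) \<and> Cod B (F\<^sub>1 f) = F\<^sub>0 (Cod A f)) \<and>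
     (\<forall>a\<in>Obj A. F\<^sub>1 (Ident A a) = Ident B (F\<^sub>0 a)) \<and>
     (\<forall>g\<in>Mor A. \<forall>h\<in>Mor A. Cod A g = Dom A h \<longrightarrow>
        F\<^sub>1 (Comp A h g) = Comp B (F\<^sub>1 h) (F\<^sub>1 g))}"

definition functor_comp ::
  "('o, 'm) category \<Rightarrow> ('p, 'n, 'q, 'r) cat_functor \<Rightarrow> ('o, 'm, 'p, 'n) cat_functor
     \<Rightarrow> ('o, 'm, 'q, 'r) cat_functor" where
  "functor_comp A G F = (compose (Obj A) (fst G) (fst F), compose (Mor A) (snd G) (snd F))"

definition ordinal_functor :: "nat \<Rightarrow> (nat \<Rightarrow> nat) \<Rightarrow> (nat, nat \<times> nat, nat, nat \<times> nat) cat_functor"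
  where "ordinal_functor m \<theta> =
    (restrict \<theta> {..m}, \<lambda>(i, j)\<in>Mor (ordinal_category m). (\<theta> i, \<theta> j))"

definition nerve :: "('o, 'm) category \<Rightarrow> (nat, nat \<times> nat, 'o, 'm) cat_functor sset" where
  "nerve C =
     \<lparr>simplices = (\<lambda>n. functors (ordinal_category n) C),
      act = (\<lambda>m n \<theta> F. functor_comp (ordinal_category m) F (ordinal_functor m \<theta>))\<rparr>"

lemma mem_simplices_nerve:
  "(F\<^sub>0, F\<^sub>1) \<in> simplices (nerve C) n \<longleftrightarrow>
     F\<^sub>0 \<in> {..n} \<rightarrow>\<^sub>E Obj C \<and> F\<^sub>1 \<in> {(i, j). i \<le> j \<and> j \<le> n} \<rightarrow>\<^sub>E Mor C \<and>
     (\<forall>i j. i \<le> j \<and> j \<le> n \<longrightarrow> Dom C (F\<^sub>1 (i, j)) = F\<^sub>0 i \<and> Cod C (F\<^sub>1 (i, j)) = F\<^sub>0 j) \<and>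
     (\<forall>i\<le>n. F\<^sub>1 (i, i) = Ident C (F\<^sub>0 i)) \<and>
     (\<forall>i j k. i \<le> j \<and> j \<le> k \<and> k \<le> n \<longrightarrow>
        F\<^sub>1 (i, k) = Comp C (F\<^sub>1 (j, k)) (F\<^sub>1 (i, j)))" (is "?lhs \<longleftrightarrow> ?rhs")
proof -
  let ?M = "{(i, j). i \<le> j \<and> j \<le> n}"
  have "(\<forall>f\<in>?M. Dom C (F\<^sub>1 f) = F\<^sub>0 (fst f) \<and> Cod C (F\<^sub>1 f) = F\<^sub>0 (snd f)) \<longleftrightarrow>
      (\<forall>i j. i \<le> j \<and> j \<le> n \<longrightarrow> Dom C (F\<^sub>1 (i, j)) = F\<^sub>0 i \<and> Cod C (F\<^sub>1 (i, j)) = F\<^sub>0 j)"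
    by force
  moreover have "(\<forall>g\<in>?M. \<forall>h\<in>?M. snd g = fst h \<longrightarrow>
        F\<^sub>1 (fst g, snd h) = Comp C (F\<^sub>1 h) (F\<^sub>1 g)) \<longleftrightarrow>
      (\<forall>i j k. i \<le> j \<and> j \<le> k \<and> k \<le> n \<longrightarrow>
        F\<^sub>1 (i, k) = Comp C (F\<^sub>1 (j, k)) (F\<^sub>1 (i, j)))" (is "?L \<longleftrightarrow> ?R")
  proof
    assume L: ?L
    show ?R
    proof (intro allI impI)
      fix i j k
      assume ijk: "i \<le> j \<and> j \<le> k \<and> k \<le> n"
      then have "(i, j) \<in> ?M" "(j, k) \<in> ?M"
        by auto
      from L[THEN bspec, OF this(1), THEN bspec, OF this(2)]
      show "F\<^sub>1 (i, k) = Comp C (F\<^sub>1 (j, k)) (F\<^sub>1 (i, j))"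
        by (simp only: fst_conv snd_conv simp_thms)
    qed
  next
    assume R: ?R
    show ?L
    proof (intro ballI impI)
      fix g h
      assume "g \<in> ?M" "h \<in> ?M" "snd g = fst h"
      moreover obtain i j where "g = (i, j)"
        by fastforce
      moreover obtain j' k where "h = (j', k)"
        by fastforce
      ultimately show "F\<^sub>1 (fst g, snd h) = Comp C (F\<^sub>1 h) (F\<^sub>1 g)"
        using R[rule_format, of i j k] by fastforce
    qed
  qed
  ultimately show ?thesis
    by (simp add: nerve_def functors_def ordinal_category_def Ball_def)
qed

lemma simplicial_set_nerve: "simplicial_set (nerve C)"
proof
  fix \<theta> m n x
  assume \<theta>: "\<theta> \<in> monotone_maps m n" and x: "x \<in> simplices (nerve C) n"
  have mono: "i \<le> j \<Longrightarrow> j \<le> m \<Longrightarrow> \<theta> i \<le> \<theta> j" and bound: "j \<le> m \<Longrightarrow> \<theta> j \<le> n" for i j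
    using \<theta> by (auto simp: monotone_maps_def monotone_on_def PiE_iff)
  obtain F\<^sub>0 F\<^sub>1 where F: "x = (F\<^sub>0, F\<^sub>1)"
    by fastforce
  note x' = x[unfolded F mem_simplices_nerve]
  have obj: "F\<^sub>0 i \<in> Obj C" "F\<^sub>1 (i, i) = Ident C (F\<^sub>0 i)" if "i \<le> n" for i
    using x' that by blast+
  have mor: "F\<^sub>1 (i, j) \<in> Mor C" "Dom C (F\<^sub>1 (i, j)) = F\<^sub>0 i" "Cod C (F\<^sub>1 (i, j)) = F\<^sub>0 j"
    if "i \<le> j" "j \<le> n" for i j
    using x' that by blast+
  have comp: "F\<^sub>1 (i, k) = Comp C (F\<^sub>1 (j, k)) (F\<^sub>1 (i, j))"
    if "i \<le> j" "j \<le> k" "k \<le> n" for i j k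
    using x' that by blast
  have "act (nerve C) m n \<theta> x
      = (\<lambda>i\<in>{..m}. F\<^sub>0 (\<theta> i), \<lambda>(i, j)\<in>{(i, j). i \<le> j \<and> j \<le> m}. F\<^sub>1 (\<theta> i, \<theta> j))"
    by (auto simp: F nerve_def functor_comp_def ordinal_functor_def ordinal_category_def
        compose_def fun_eq_iff)
  moreover have "\<dots> \<in> simplices (nerve C) m"
    unfolding mem_simplices_nerve
    by (auto simp: obj mor mono bound intro: comp)
  ultimately show "act (nerve C) m n \<theta> x \<in> simplices (nerve C) m"
    by simp
next
  fix x n
  assume x: "x \<in> simplices (nerve C) n"
  obtain F\<^sub>0 F\<^sub>1 where F: "x = (F\<^sub>0, F\<^sub>1)"
    by fastforce
  have "F\<^sub>0 \<in> extensional {..n}" "F\<^sub>1 \<in> extensional {(i, j). i \<le> j \<and> j \<le> n}"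
    using x[unfolded F mem_simplices_nerve PiE_iff] by blast+
  then show "act (nerve C) n n (restrict id {..n}) x = x"
    by (auto simp: F nerve_def functor_comp_def ordinal_functor_def
        ordinal_category_def compose_def extensional_def fun_eq_iff)
next
  fix \<phi> \<theta> :: "nat \<Rightarrow> nat" and l m n x
  assume \<phi>: "\<phi> \<in> monotone_maps l m"
  have mono: "i \<le> j \<Longrightarrow> j \<le> l \<Longrightarrow> \<phi> i \<le> \<phi> j" and bound: "j \<le> l \<Longrightarrow> \<phi> j \<le> m" for i j
    using \<phi> by (auto simp: monotone_maps_def monotone_on_def PiE_iff)
  show "act (nerve C) l n (compose {..l} \<theta> \<phi>) x
      = act (nerve C) l m \<phi> (act (nerve C) m n \<theta> x)"
    by (auto simp: nerve_def functor_comp_def ordinal_functor_def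
        ordinal_category_def compose_def mono bound fun_eq_iff)
qed


section \<open>Geometric realization\<close>

text \<open>The affine map \<open>\<Delta>\<^sup>m \<rightarrow> \<Delta>\<^sup>n\<close> that extends \<open>\<theta> : [m] \<rightarrow> [n]\<close> on vertices.\<close>

definition simplex_push :: "nat \<Rightarrow> (nat \<Rightarrow> nat) \<Rightarrow> (nat \<Rightarrow> real) \<Rightarrow> (nat \<Rightarrow> real)" where
  "simplex_push m \<theta> t = (\<lambda>j. \<Sum>i | i \<le> m \<and> \<theta> i = j. t i)"

lemma simplex_push_in_standard_simplex:
  assumes \<theta>: "\<theta> \<in> monotone_maps m n" and t: "t \<in> standard_simplex m"
  shows "simplex_push m \<theta> t \<in> standard_simplex n"
proof -
  have nonneg: "\<And>i. 0 \<le> t i" and total: "(\<Sum>i\<le>m. t i) = 1"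
    using t by (auto simp: standard_simplex_def)
  have into: "\<And>i. i \<le> m \<Longrightarrow> \<theta> i \<le> n"
    using \<theta> by (auto simp: monotone_maps_def PiE_iff)
  have "simplex_push m \<theta> t j \<le> (\<Sum>i\<le>m. t i)" for j
    unfolding simplex_push_def by (rule sum_mono2) (auto simp: nonneg)
  moreover have "0 \<le> simplex_push m \<theta> t j" for j
    unfolding simplex_push_def by (rule sum_nonneg) (simp add: nonneg)
  moreover have "simplex_push m \<theta> t j = 0" if "n < j" for j
  proof -
    have "{i. i \<le> m \<and> \<theta> i = j} = {}"
      using into that by fastforce
    then show ?thesis
      by (simp only: simplex_push_def sum.empty)
  qed
  moreover have "(\<Sum>j\<le>n. simplex_push m \<theta> t j) = 1"
    using sum.group[of "{..m}" "{..n}" \<theta> t] into total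
    by (auto simp: simplex_push_def image_subset_iff)
  ultimately show ?thesis
    using total by (simp add: standard_simplex_def)
qed

text \<open>The coproduct \<open>\<Coprod>\<^sub>n X\<^sub>n \<times> \<Delta>\<^sup>n\<close>, with each \<open>X\<^sub>n\<close> discrete.\<close>

definition simplex_sum :: "'x sset \<Rightarrow> (nat \<times> 'x \<times> (nat \<Rightarrow> real)) topology" where
  "simplex_sum X = sum_topology
     (\<lambda>n. prod_topology (discrete_topology (simplices X n))
            (subtopology (powertop_real UNIV) (standard_simplex n))) UNIV"

inductive glue :: "'x sset \<Rightarrow> nat \<times> 'x \<times> (nat \<Rightarrow> real) \<Rightarrow> nat \<times> 'x \<times> (nat \<Rightarrow> real) \<Rightarrow> bool"
  for X where
  "\<lbrakk>\<theta> \<in> monotone_maps m n; x \<in> simplices X n; t \<in> standard_simplex m\<rbrakk>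
    \<Longrightarrow> glue X (m, act X m n \<theta> x, t) (n, x, simplex_push m \<theta> t)"

definition glue_equiv ::
  "'x sset \<Rightarrow> ((nat \<times> 'x \<times> (nat \<Rightarrow> real)) \<times> (nat \<times> 'x \<times> (nat \<Rightarrow> real))) set" where
  "glue_equiv X =
     {(p, q). p \<in> topspace (simplex_sum X) \<and> q \<in> topspace (simplex_sum X) \<and> equivclp (glue X) p q}"

definition quotient_topology :: "'a topology \<Rightarrow> ('a \<Rightarrow> 'b) \<Rightarrow> 'b topology" where
  "quotient_topology X q =
     topology (\<lambda>U. U \<subseteq> q ` topspace X \<and> openin X {x \<in> topspace X. q x \<in> U})"

lemma openin_quotient_topology:
  "openin (quotient_topology X q) U \<longleftrightarrow>
     U \<subseteq> q ` topspace X \<and> openin X {x \<in> topspace X. q x \<in> U}"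
proof -
  have "istopology (\<lambda>U. U \<subseteq> q ` topspace X \<and> openin X {x \<in> topspace X. q x \<in> U})"
    unfolding istopology_def
  proof (intro conjI allI impI)
    fix S T
    assume S: "S \<subseteq> q ` topspace X \<and> openin X {x \<in> topspace X. q x \<in> S}"
      and T: "T \<subseteq> q ` topspace X \<and> openin X {x \<in> topspace X. q x \<in> T}"
    have "{x \<in> topspace X. q x \<in> S \<inter> T}
        = {x \<in> topspace X. q x \<in> S} \<inter> {x \<in> topspace X. q x \<in> T}"
      by blast
    with S T show "openin X {x \<in> topspace X. q x \<in> S \<inter> T}"
      by (simp only: openin_Int)
    show "S \<inter> T \<subseteq> q ` topspace X"
      using S by blast
  next
    fix \<K>
    assume K: "\<forall>K\<in>\<K>. K \<subseteq> q ` topspace X \<and> openin X {x \<in> topspace X. q x \<in> K}"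
    have "{x \<in> topspace X. q x \<in> \<Union>\<K>} = (\<Union>K\<in>\<K>. {x \<in> topspace X. q x \<in> K})"
      by blast
    with K show "openin X {x \<in> topspace X. q x \<in> \<Union>\<K>}"
      by (auto intro!: openin_Union)
    show "\<Union>\<K> \<subseteq> q ` topspace X"
      using K by blast
  qed
  then show ?thesis
    by (simp add: quotient_topology_def topology_inverse')
qed

lemma topspace_quotient_topology: "topspace (quotient_topology X q) = q ` topspace X"
proof (rule antisym)
  show "topspace (quotient_topology X q) \<subseteq> q ` topspace X"
    by (metis openin_quotient_topology openin_topspace)
  have "{x \<in> topspace X. q x \<in> q ` topspace X} = topspace X"
    by blast
  then show "q ` topspace X \<subseteq> topspace (quotient_topology X q)"
    by (intro openin_subset) (simp add: openin_quotient_topology)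
qed

lemma quotient_map_quotient_topology: "quotient_map X (quotient_topology X q) q"
  by (auto simp: quotient_map_def topspace_quotient_topology openin_quotient_topology)

definition geometric_realization ::
  "'x sset \<Rightarrow> (nat \<times> 'x \<times> (nat \<Rightarrow> real)) set topology" where
  "geometric_realization X = quotient_topology (simplex_sum X) (\<lambda>p. glue_equiv X `` {p})"

text \<open>
  For a simplicial subset \<open>Y\<close> of \<open>X\<close>, the canonical map \<open>|Y| \<rightarrow> |X|\<close>: it sends the class of a
  point in the realization of \<open>Y\<close> to the class of the same point in the realization of \<open>X\<close>.
\<close>

definition realization_inclusion ::
  "'x sset \<Rightarrow> (nat \<times> 'x \<times> (nat \<Rightarrow> real)) set \<Rightarrow> (nat \<times> 'x \<times> (nat \<Rightarrow> real)) set" where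
  "realization_inclusion X c = glue_equiv X `` c"

lemma realization_inclusion_class:
  assumes "simplicial_subset Y X" and p: "p \<in> topspace (simplex_sum Y)"
  shows "realization_inclusion X (glue_equiv Y `` {p}) = glue_equiv X `` {p}"
proof -
  have sub: "simplices Y n \<subseteq> simplices X n" for n
    using assms(1) by (simp add: simplicial_subset_def)
  have act: "act Y m n \<theta> x = act X m n \<theta> x" if "\<theta> \<in> monotone_maps m n" "x \<in> simplices Y n"
    for m n \<theta> x
    using assms(1) that by (simp add: simplicial_subset_def)
  have top: "topspace (simplex_sum Y) \<subseteq> topspace (simplex_sum X)"
    using sub by (fastforce simp: simplex_sum_def)
  have glue: "glue X a b" if "glue Y a b" for a b
    using that
  proof cases
    case (1 \<theta> m n x t)
    then have "x \<in> simplices X n"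
      using sub by blast
    then show ?thesis
      using glue.intros[of \<theta> m n x X t] 1 by (simp add: act)
  qed
  have equiv: "equivclp (glue X) a b" if "equivclp (glue Y) a b" for a b
    using that
    by (induction rule: equivclp_induct) (auto intro: equivclp_into_equivclp dest: glue)
  have "(p, p) \<in> glue_equiv Y"
    using p by (simp add: glue_equiv_def)
  then show ?thesis
    using top equiv equivclp_sym[of "glue X"] equivclp_trans[of "glue X"]
    unfolding realization_inclusion_def glue_equiv_def by blast
qed


section \<open>Deformation retracts\<close>

text \<open>The homotopy is required to be constant on the retract.\<close>

definition deformation_retract_of_space :: "'a set \<Rightarrow> 'a topology \<Rightarrow> bool"
  (infix \<open>deformation'_retract'_of'_space\<close> 50) where
  "A deformation_retract_of_space X \<longleftrightarrow> A \<subseteq> topspace X \<and>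
     (\<exists>r. continuous_map X (subtopology X A) r \<and> (\<forall>x\<in>A. r x = x) \<and>
          homotopic_with (\<lambda>h. \<forall>x\<in>A. h x = x) X X id r)"

end

theory Submission
  imports Defs
begin

text \<open>
  Unique factorization says that \<open>C\<close> is the free category on its quiver of irreducible morphisms.
  An \<open>n\<close>-simplex \<open>F\<close> of the nerve with long edge \<open>f = e\<^sub>N \<circ> \<dots> \<circ> e\<^sub>1\<close> is therefore obtained from the
  \<open>N\<close>-simplex \<open>G\<close> spelled by \<open>e\<^sub>1, \<dots>, e\<^sub>N\<close> by restriction along the map \<open>[n] \<rightarrow> [N]\<close> that records the
  number of irreducible factors of \<open>F(0, i)\<close>. Send a point \<open>u\<close> of \<open>\<Delta>\<^sup>N\<close> to the point of the spine
  \<open>0 \<rightarrow> 1 \<rightarrow> \<dots> \<rightarrow> N\<close> at distance \<open>\<Sum>i. i * u\<^sub>i\<close> from \<open>0\<close>. This retraction, and the straight-line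
  homotopy from the identity to it, commute with the inclusions of intervals \<open>[M] \<rightarrow> [N]\<close>,
  \<open>i \<mapsto> i + a\<close>. Passing to a face of \<open>F\<close> changes \<open>G\<close> only by such an inclusion, so both descend to the
  geometric realization. The retraction lands in the simplicial subset of those \<open>F\<close> whose long edge
  has at most one factor, on which the homotopy is constant. It also has a continuous lift to
  the realization of this subset; the lift is a left inverse of the inclusion, which is thus an
  embedding.
\<close>

section \<open>Maps out of a geometric realization\<close>

definition realization_point :: "'x sset \<Rightarrow> nat \<Rightarrow> 'x \<Rightarrow> (nat \<Rightarrow> real) \<Rightarrow> (nat \<times> 'x \<times> (nat \<Rightarrow> real)) set"
  where "realization_point X n x t = glue_equiv X `` {(n, x, t)}"

abbreviation simplex_space :: "nat \<Rightarrow> (nat \<Rightarrow> real) topology" where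
  "simplex_space n \<equiv> subtopology (powertop_real UNIV) (standard_simplex n)"

lemma topspace_simplex_sum:
  "topspace (simplex_sum X) = {(n, x, t). x \<in> simplices X n \<and> t \<in> standard_simplex n}"
  by (auto simp: simplex_sum_def)

lemma topspace_geometric_realization:
  "topspace (geometric_realization X) =
     {realization_point X n x t |n x t. x \<in> simplices X n \<and> t \<in> standard_simplex n}"
  by (auto simp: geometric_realization_def topspace_quotient_topology topspace_simplex_sum
      realization_point_def)

lemma equiv_glue_equiv: "equiv (topspace (simplex_sum X)) (glue_equiv X)"
proof (rule equivI)
  show "refl_on (topspace (simplex_sum X)) (glue_equiv X)"
    by (auto simp: refl_on_def glue_equiv_def)
  show "sym (glue_equiv X)"
    by (auto simp: sym_def glue_equiv_def intro: equivclp_sym)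
  show "trans (glue_equiv X)"
    by (auto simp: trans_def glue_equiv_def intro: equivclp_trans)
qed (auto simp: glue_equiv_def)

text \<open>One generator of \<open>glue\<close>. The identifications of points in the rest of the
  proof are obtained from this equation.\<close>

lemma (in simplicial_set) realization_point_act:
  assumes "\<theta> \<in> monotone_maps m n" "x \<in> simplices X n" "t \<in> standard_simplex m"
  shows "realization_point X m (act X m n \<theta> x) t = realization_point X n x (simplex_push m \<theta> t)"
proof -
  have "((m, act X m n \<theta> x, t), (n, x, simplex_push m \<theta> t)) \<in> glue_equiv X"
    using glue.intros[OF assms] assms act_in simplex_push_in_standard_simplex
    by (auto simp: glue_equiv_def topspace_simplex_sum)
  then show ?thesis
    unfolding realization_point_def by (metis equiv_class_eq equiv_glue_equiv)
qed

lemma realization_inclusion_point: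
  assumes "simplicial_subset Y X" "x \<in> simplices Y n" "t \<in> standard_simplex n"
  shows "realization_inclusion X (realization_point Y n x t) = realization_point X n x t"
  using realization_inclusion_class[OF assms(1), of "(n, x, t)"] assms(2,3)
  by (simp add: topspace_simplex_sum realization_point_def)

text \<open>Each simplex is an open piece of the coproduct, so continuity can be tested on one
  simplex at a time, with the parameter in \<open>K\<close> carried along.\<close>

lemma continuous_map_prod_simplex_sum:
  assumes "\<And>n x. x \<in> simplices X n \<Longrightarrow>
    continuous_map (prod_topology K (simplex_space n)) Z (\<lambda>(k, t). f k n x t)"
  shows "continuous_map (prod_topology K (simplex_sum X)) Z (\<lambda>(k, n, x, t). f k n x t)"
  unfolding continuous_map_def
proof (intro conjI allI impI)
  show "(\<lambda>(k, n, x, t). f k n x t) \<in> topspace (prod_topology K (simplex_sum X)) \<rightarrow> topspace Z"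
  proof
    fix q
    assume "q \<in> topspace (prod_topology K (simplex_sum X))"
    then obtain k n x t where "q = (k, n, x, t)" "k \<in> topspace K" "x \<in> simplices X n"
      "t \<in> standard_simplex n"
      by (auto simp: topspace_simplex_sum)
    with continuous_map_funspace[OF assms, of x n] show "(\<lambda>(k, n, x, t). f k n x t) q \<in> topspace Z"
      by (auto simp: Pi_iff)
  qed
next
  fix U
  assume U: "openin Z U"
  let ?W = "{p \<in> topspace (prod_topology K (simplex_sum X)). (\<lambda>(k, n, x, t). f k n x t) p \<in> U}"
  show "openin (prod_topology K (simplex_sum X)) ?W"
    unfolding openin_prod_topology_alt
  proof (intro allI impI)
    fix k p
    assume kp: "(k, p) \<in> ?W"
    obtain n x t where p: "p = (n, x, t)"
      by (cases p)
    have k: "k \<in> topspace K" and x: "x \<in> simplices X n" and t: "t \<in> standard_simplex n"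
      and fU: "f k n x t \<in> U"
      using kp by (auto simp: p topspace_simplex_sum)
    have "openin (prod_topology K (simplex_space n))
        {q \<in> topspace (prod_topology K (simplex_space n)). (\<lambda>(k, t). f k n x t) q \<in> U}"
      using assms[OF x] U by (simp add: continuous_map_def)
    moreover have "(k, t) \<in>
        {q \<in> topspace (prod_topology K (simplex_space n)). (\<lambda>(k, t). f k n x t) q \<in> U}"
      using k t fU by simp
    ultimately obtain V T where V: "openin K V" "k \<in> V"
      and T: "openin (simplex_space n) T" "t \<in> T"
      and sub: "V \<times> T \<subseteq>
        {q \<in> topspace (prod_topology K (simplex_space n)). (\<lambda>(k, t). f k n x t) q \<in> U}"
      unfolding openin_prod_topology_alt by blast
    \<comment> \<open>The simplices carry the discrete topology, so the single simplex
      \<open>x\<close> is open.\<close>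
    have "openin (prod_topology (discrete_topology (simplices X n)) (simplex_space n)) ({x} \<times> T)"
      using x T by (simp add: openin_prod_Times_iff)
    then have "openin (simplex_sum X) (SIGMA m:UNIV. if m = n then {x} \<times> T else {})"
      unfolding simplex_sum_def openin_disjoint_union by simp
    moreover have "(SIGMA m:UNIV. if m = n then {x} \<times> T else {}) = Pair n ` ({x} \<times> T)"
      by (auto split: if_splits)
    ultimately have "openin (simplex_sum X) (Pair n ` ({x} \<times> T))"
      by simp
    moreover have "V \<times> Pair n ` ({x} \<times> T) \<subseteq> ?W"
      using sub x by (auto simp: topspace_simplex_sum)
    ultimately show "\<exists>V T. openin K V \<and> openin (simplex_sum X) T \<and> k \<in> V \<and> p \<in> T \<and> V \<times> T \<subseteq> ?W"
      using V T p by blast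
  qed
qed

lemma quotient_map_realization:
  "quotient_map (simplex_sum X) (geometric_realization X) (\<lambda>p. glue_equiv X `` {p})"
  by (simp add: geometric_realization_def quotient_map_quotient_topology)

lemma continuous_map_realization_point:
  assumes "x \<in> simplices X n"
  shows "continuous_map (simplex_space n) (geometric_realization X) (realization_point X n x)"
proof -
  have "continuous_map (simplex_space n)
      (prod_topology (discrete_topology (simplices X n)) (simplex_space n)) (Pair x)"
    using assms by (intro continuous_map_pairedI) auto
  then have "continuous_map (simplex_space n) (simplex_sum X) (Pair n \<circ> Pair x)"
    unfolding simplex_sum_def
    by (rule continuous_map_compose) (rule continuous_map_component_injection, simp)
  then have "continuous_map (simplex_space n) (geometric_realization X)
      ((\<lambda>p. glue_equiv X `` {p}) \<circ> (Pair n \<circ> Pair x))"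
    by (rule continuous_map_compose)
      (rule quotient_imp_continuous_map[OF quotient_map_realization])
  then show ?thesis
    by (simp add: o_def realization_point_def[abs_def])
qed

text \<open>Taking the product with a locally compact Hausdorff space preserves quotient maps. This
  lets a homotopy be defined simplex by simplex; \<open>K\<close> is later the unit
  interval.\<close>

lemma (in simplicial_set) realization_lift_prod:
  assumes K: "locally_compact_space K" "Hausdorff_space K"
    and cont: "\<And>n x. x \<in> simplices X n \<Longrightarrow>
      continuous_map (prod_topology K (simplex_space n)) Z (\<lambda>(k, t). f k n x t)"
    and compat: "\<And>k m n \<theta> x t. \<lbrakk>k \<in> topspace K; \<theta> \<in> monotone_maps m n; x \<in> simplices X n;
      t \<in> standard_simplex m\<rbrakk> \<Longrightarrow> f k m (act X m n \<theta> x) t = f k n x (simplex_push m \<theta> t)"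
  obtains g where "continuous_map (prod_topology K (geometric_realization X)) Z g"
    "\<And>k n x t. \<lbrakk>k \<in> topspace K; x \<in> simplices X n; t \<in> standard_simplex n\<rbrakk> \<Longrightarrow>
      g (k, realization_point X n x t) = f k n x t"
proof -
  let ?q = "\<lambda>(k, p). (k, glue_equiv X `` {p})"
  let ?f = "\<lambda>(k, n, x, t). f k n x t"
  have quot: "quotient_map (prod_topology K (simplex_sum X))
      (prod_topology K (geometric_realization X)) ?q"
    using K by (intro quotient_map_prod_right quotient_map_realization) auto
  \<comment> \<open>Compatibility is given for the generators of the relation; induction carries it
    to the generated equivalence.\<close>
  have equiv: "(\<lambda>(n, x, t). f k n x t) p = (\<lambda>(n, x, t). f k n x t) q"
    if "equivclp (glue X) p q" "k \<in> topspace K" for k p q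
    using that(1)
  proof (induction rule: equivclp_induct)
    case base
    show ?case ..
  next
    case (step y z)
    have "(\<lambda>(n, x, t). f k n x t) y = (\<lambda>(n, x, t). f k n x t) z" if "glue X y z" for y z
      using that compat[OF \<open>k \<in> topspace K\<close>] by cases simp
    then show ?case
      using step by metis
  qed
  have "?f p = ?f p'"
    if pp: "p \<in> topspace (prod_topology K (simplex_sum X))"
      "p' \<in> topspace (prod_topology K (simplex_sum X))" "?q p = ?q p'" for p p'
  proof -
    obtain k a k' a' where p: "p = (k, a)" "p' = (k', a')"
      by (cases p, cases p')
    have "(a, a') \<in> glue_equiv X" "k \<in> topspace K" "k' = k"
      using pp eq_equiv_class[OF _ equiv_glue_equiv, of X a a'] by (auto simp: p)
    then show ?thesis
      using equiv[of a a' k] by (simp add: p glue_equiv_def)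
  qed
  note lift = quotient_map_lift_exists[OF quot continuous_map_prod_simplex_sum[OF cont] this]
  obtain g where g: "continuous_map (prod_topology K (geometric_realization X)) Z g"
    "\<And>p. p \<in> topspace (prod_topology K (simplex_sum X)) \<Longrightarrow> g (?q p) = ?f p"
  proof (rule lift)
    fix g
    assume "continuous_map (prod_topology K (geometric_realization X)) Z g"
      "\<And>p. p \<in> topspace (prod_topology K (simplex_sum X)) \<Longrightarrow> g (?q p) = ?f p"
    then show thesis
      by (rule that)
  qed
  show ?thesis
  proof
    show "g (k, realization_point X n x t) = f k n x t"
      if "k \<in> topspace K" "x \<in> simplices X n" "t \<in> standard_simplex n" for k n x t
      using that g(2)[of "(k, n, x, t)"] by (simp add: topspace_simplex_sum realization_point_def)
  qed (rule g(1))
qed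

text \<open>The case without parameter, obtained from the product version with a one-point space
  \<open>K\<close>.\<close>

lemma (in simplicial_set) realization_lift:
  assumes cont: "\<And>n x. x \<in> simplices X n \<Longrightarrow> continuous_map (simplex_space n) Z (f n x)"
    and compat: "\<And>m n \<theta> x t. \<lbrakk>\<theta> \<in> monotone_maps m n; x \<in> simplices X n;
      t \<in> standard_simplex m\<rbrakk> \<Longrightarrow> f m (act X m n \<theta> x) t = f n x (simplex_push m \<theta> t)"
  obtains g where "continuous_map (geometric_realization X) Z g"
    "\<And>n x t. \<lbrakk>x \<in> simplices X n; t \<in> standard_simplex n\<rbrakk> \<Longrightarrow>
      g (realization_point X n x t) = f n x t"
proof -
  let ?K = "discrete_topology UNIV :: unit topology"
  have cont': "continuous_map (prod_topology ?K (simplex_space n)) Z (\<lambda>(k, t). f n x t)"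
    if "x \<in> simplices X n" for n x
    using continuous_map_compose[OF continuous_map_snd cont[OF that]]
    by (simp add: o_def case_prod_unfold)
  obtain g where g: "continuous_map (prod_topology ?K (geometric_realization X)) Z g"
    "\<And>k n x t. \<lbrakk>x \<in> simplices X n; t \<in> standard_simplex n\<rbrakk> \<Longrightarrow>
      g (k, realization_point X n x t) = f n x t"
    by (rule realization_lift_prod[of ?K Z "\<lambda>_. f"])
      (auto simp: Hausdorff_space_discrete_topology locally_compact_space_discrete_topology cont' compat)
  have "continuous_map (geometric_realization X)
      (prod_topology ?K (geometric_realization X)) (Pair ())"
    by (intro continuous_map_pairedI) auto
  then have "continuous_map (geometric_realization X) Z (g \<circ> Pair ())"
    using g(1) by (rule continuous_map_compose)
  then show ?thesis
    using that g(2) by simp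
qed

lemma continuous_map_realization_inclusion:
  assumes "simplicial_subset Y X" "simplicial_set X"
  shows "continuous_map (geometric_realization Y) (geometric_realization X)
    (realization_inclusion X)"
proof -
  interpret X: simplicial_set X
    by fact
  interpret Y: simplicial_set Y
    using assms(1) by (simp add: simplicial_subset_def)
  have sub: "x \<in> simplices X n" if "x \<in> simplices Y n" for x n
    using assms(1) that by (auto simp: simplicial_subset_def)
  have compat: "realization_point X m (act Y m n \<theta> x) t = realization_point X n x (simplex_push m \<theta> t)"
    if "\<theta> \<in> monotone_maps m n" "x \<in> simplices Y n" "t \<in> standard_simplex m" for m n \<theta> x t
    using that assms(1) X.realization_point_act[of \<theta> m n x t] sub
    by (simp add: simplicial_subset_def)
  obtain g where g: "continuous_map (geometric_realization Y) (geometric_realization X) g"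
    "\<And>n x t. \<lbrakk>x \<in> simplices Y n; t \<in> standard_simplex n\<rbrakk> \<Longrightarrow>
      g (realization_point Y n x t) = realization_point X n x t"
    by (rule Y.realization_lift[OF continuous_map_realization_point[OF sub] compat])
        (assumption | rule that | simp only:)+
  show ?thesis
    by (rule continuous_map_eq[OF g(1)])
      (auto simp: topspace_geometric_realization g(2) realization_inclusion_point[OF assms(1)])
qed

section \<open>Points of standard simplices\<close>

lemma simplex_push_cong:
  "(\<And>i. i \<le> m \<Longrightarrow> \<theta> i = \<theta>' i) \<Longrightarrow> simplex_push m \<theta> t = simplex_push m \<theta>' t"
  unfolding simplex_push_def by (intro ext sum.cong) auto

text \<open>The weight arriving at \<open>j\<close> is a sum over the fibre of the composite, which
  can be grouped by the intermediate vertex.\<close>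

lemma simplex_push_compose:
  assumes "\<And>i. i \<le> l \<Longrightarrow> \<phi> i \<le> m"
  shows "simplex_push m \<theta> (simplex_push l \<phi> t) = simplex_push l (\<lambda>i. \<theta> (\<phi> i)) t"
proof
  fix j
  have "(\<Sum>i | i \<le> m \<and> \<theta> i = j. \<Sum>k | k \<le> l \<and> \<phi> k = i. t k) =
      (\<Sum>i | i \<le> m \<and> \<theta> i = j. \<Sum>k | k \<in> {k. k \<le> l \<and> \<theta> (\<phi> k) = j} \<and> \<phi> k = i. t k)"
    by (intro sum.cong) auto
  also have "\<dots> = (\<Sum>k | k \<le> l \<and> \<theta> (\<phi> k) = j. t k)"
    using assms by (intro sum.group) auto
  finally show "simplex_push m \<theta> (simplex_push l \<phi> t) j = simplex_push l (\<lambda>i. \<theta> (\<phi> i)) t j"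
    by (simp add: simplex_push_def)
qed

lemma simplex_push_convex:
  "simplex_push m \<theta> (\<lambda>i. (1 - s) * u i + s * v i) =
     (\<lambda>j. (1 - s) * simplex_push m \<theta> u j + s * simplex_push m \<theta> v j)"
  by (simp add: simplex_push_def sum.distrib sum_distrib_left)

lemma simplex_push_shift:
  "simplex_push m (\<lambda>i. i + a) t = (\<lambda>j. if a \<le> j \<and> j \<le> a + m then t (j - a) else 0)"
proof
  fix j
  have "{i. i \<le> m \<and> i + a = j} = (if a \<le> j \<and> j \<le> a + m then {j - a} else {})"
    by auto
  then show "simplex_push m (\<lambda>i. i + a) t j = (if a \<le> j \<and> j \<le> a + m then t (j - a) else 0)"
    by (simp add: simplex_push_def)
qed

lemma continuous_map_simplex_push:
  assumes "continuous_map K (powertop_real UNIV) t"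
  shows "continuous_map K (powertop_real UNIV) (\<lambda>k. simplex_push m \<theta> (t k))"
  using assms unfolding simplex_push_def continuous_map_componentwise_UNIV
  by (auto intro!: continuous_map_sum)

text \<open>On the standard simplex this is the affine function with value \<open>i\<close> at
  vertex \<open>i\<close>.\<close>

definition mean :: "nat \<Rightarrow> (nat \<Rightarrow> real) \<Rightarrow> real" where
  "mean n u = (\<Sum>i\<le>n. real i * u i)"

lemma continuous_map_mean:
  assumes "continuous_map K (powertop_real UNIV) t"
  shows "continuous_map K euclideanreal (\<lambda>k. mean m (t k))"
  using assms unfolding mean_def continuous_map_componentwise_UNIV
  by (auto intro!: continuous_map_sum continuous_map_real_mult_left)

lemma mean_bounds:
  assumes "u \<in> standard_simplex n"
  shows "0 \<le> mean n u" "mean n u \<le> real n"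
proof -
  have u: "\<And>i. 0 \<le> u i" "(\<Sum>i\<le>n. u i) = 1"
    using assms by (auto simp: standard_simplex_def)
  show "0 \<le> mean n u"
    unfolding mean_def using u by (intro sum_nonneg) auto
  have "mean n u \<le> (\<Sum>i\<le>n. real n * u i)"
    unfolding mean_def using u by (intro sum_mono mult_right_mono) auto
  also have "\<dots> = real n"
    by (simp add: u flip: sum_distrib_left)
  finally show "mean n u \<le> real n" .
qed

text \<open>Every vertex number is raised by \<open>a\<close>, and the total weight is 1.\<close>

lemma mean_shift:
  assumes u: "u \<in> standard_simplex m" and "a + m \<le> n"
  shows "mean n (simplex_push m (\<lambda>i. i + a) u) = mean m u + real a"
proof -
  have "mean n (simplex_push m (\<lambda>i. i + a) u) =
      (\<Sum>j\<in>{0 + a..m + a}. real j * u (j - a))"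
    unfolding mean_def simplex_push_shift using assms(2)
    by (intro sum.mono_neutral_cong_right) auto
  also have "\<dots> = (\<Sum>i\<in>{0..m}. real (i + a) * u i)"
    by (simp only: sum.shift_bounds_cl_nat_ivl) simp
  also have "\<dots> = mean m u + real a * (\<Sum>i\<le>m. u i)"
    by (simp add: mean_def algebra_simps sum.distrib sum_distrib_left atMost_atLeast0)
  finally show ?thesis
    using u by (simp add: standard_simplex_def)
qed

text \<open>
  The point at distance \<open>x\<close> from the initial vertex on the path of edges
  \<open>0 \<rightarrow> 1 \<rightarrow> 2 \<rightarrow> \<dots>\<close> of a simplex.
\<close>

definition spine_point :: "real \<Rightarrow> nat \<Rightarrow> real" where
  "spine_point x j = max 0 (1 - \<bar>x - real j\<bar>)"

text \<open>Barycentric coordinates of the point at distance \<open>y\<close> from vertex 0 on the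
  1-simplex.\<close>

definition edge_point :: "real \<Rightarrow> nat \<Rightarrow> real" where
  "edge_point y j = (if j = 0 then 1 - y else if j = 1 then y else 0)"

lemma edge_point_in_standard_simplex:
  "0 \<le> y \<Longrightarrow> y \<le> 1 \<Longrightarrow> edge_point y \<in> standard_simplex 1"
  by (auto simp: standard_simplex_def edge_point_def)

text \<open>For \<open>j = n\<close> the map is constant, which lets \<open>j = \<lfloor>x\<rfloor>\<close> include the endpoint \<open>x = n\<close>.\<close>

definition edge_map :: "nat \<Rightarrow> nat \<Rightarrow> nat \<Rightarrow> nat" where
  "edge_map n j = (\<lambda>i\<in>{..1}. min (j + i) n)"

lemma edge_map_monotone: "edge_map n j \<in> monotone_maps 1 n"
  by (auto simp: edge_map_def monotone_maps_def monotone_on_def)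

text \<open>The tent function \<open>spine_point\<close> is nonzero at most at the two vertices next
  to its argument, with the values \<open>1 - y\<close> and \<open>y\<close>.\<close>

lemma simplex_push_edge_map:
  assumes "0 \<le> y" "y \<le> 1" "real j + y \<le> real n"
  shows "simplex_push 1 (edge_map n j) (edge_point y) = spine_point (real j + y)"
proof
  fix k
  have j: "j \<le> n"
    using assms by linarith
  have "simplex_push 1 (edge_map n j) (edge_point y) k =
      (\<Sum>i\<le>1. if edge_map n j i = k then edge_point y i else 0)"
    using sum.inter_filter[of "{..1}" "edge_point y" "\<lambda>i. edge_map n j i = k"]
    by (simp add: simplex_push_def)
  also have "\<dots> = (if k = j then 1 - y else 0) + (if k = min (Suc j) n then y else 0)"
    using j by (simp add: edge_map_def edge_point_def)
  \<comment> \<open>If \<open>j = n\<close>, both ends of the edge are sent to \<open>n\<close>, and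
    the second end has weight 0.\<close>
  moreover have "y = 0" if "j = n"
    using assms that by linarith
  ultimately show "simplex_push 1 (edge_map n j) (edge_point y) k = spine_point (real j + y) k"
    using assms j
    by (cases "k = j"; cases "k = Suc j"; cases "j = n")
       (auto simp: spine_point_def min_def)
qed

text \<open>The integer part of \<open>x\<close> selects the edge, the fractional part the position
  on it. Through this formula spine points are lifted to a simplicial subset that has the edges of
  the spine but not the whole simplex.\<close>

lemma spine_point_edge:
  assumes "0 \<le> x" "x \<le> real n"
  shows "spine_point x = simplex_push 1 (edge_map n (nat \<lfloor>x\<rfloor>)) (edge_point (frac x))"
proof -
  have "real (nat \<lfloor>x\<rfloor>) + frac x = x"
    using assms by (simp add: frac_def)
  then show ?thesis
    using simplex_push_edge_map[of "frac x" "nat \<lfloor>x\<rfloor>" n] assms frac_lt_1[of x]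
    by simp
qed

lemma spine_point_in_standard_simplex:
  assumes "0 \<le> x" "x \<le> real n"
  shows "spine_point x \<in> standard_simplex n"
  unfolding spine_point_edge[OF assms]
  using frac_lt_1[of x]
  by (intro simplex_push_in_standard_simplex[OF edge_map_monotone] edge_point_in_standard_simplex)
     auto

text \<open>Tents are translation invariant, and those around vertices outside the image interval
  vanish at \<open>x + a\<close>, since \<open>x\<close> stays between 0 and
  \<open>m\<close>.\<close>

lemma simplex_push_spine_point:
  assumes "0 \<le> x" "x \<le> real m"
  shows "simplex_push m (\<lambda>i. i + a) (spine_point x) = spine_point (x + real a)"
  unfolding simplex_push_shift
proof
  fix j
  show "(if a \<le> j \<and> j \<le> a + m then spine_point x (j - a) else 0) = spine_point (x + real a) j"
  proof (cases "a \<le> j \<and> j \<le> a + m")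
    case True
    then show ?thesis
      by (simp add: spine_point_def of_nat_diff algebra_simps)
  next
    case False
    then have "real j + 1 \<le> real a \<or> real a + real m + 1 \<le> real j"
      by linarith
    then show ?thesis
      using assms False by (auto simp: spine_point_def)
  qed
qed

text \<open>A simplex of dimension at most 1 is its own spine. Constancy of the homotopy on the
  retract rests on this.\<close>

lemma spine_point_mean:
  assumes u: "u \<in> standard_simplex n" and "n \<le> 1"
  shows "spine_point (mean n u) = u"
proof -
  have out: "u i = 0" if "i > n" for i
    using u that by (auto simp: standard_simplex_def)
  have total: "(\<Sum>i\<le>n. u i) = 1" and pos: "\<And>i. 0 \<le> u i"
    using u by (auto simp: standard_simplex_def)
  show ?thesis
  proof (cases "n = 0")
    case True
    show ?thesis
    proof
      fix j
      show "spine_point (mean n u) j = u j"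
        using total out[of j] True by (cases j) (auto simp: spine_point_def mean_def)
    qed
  next
    case False
    then have n: "n = 1"
      using assms(2) by simp
    have m: "mean n u = u 1" "u 0 = 1 - u 1" "0 \<le> u 1" "u 1 \<le> 1"
      using total pos[of 0] pos[of 1] by (auto simp: n mean_def)
    show ?thesis
    proof
      fix j
      have big: "spine_point (mean n u) j = 0" if "j \<noteq> 0" "j \<noteq> 1"
      proof -
        have "2 \<le> real j"
          using that by linarith
        then show ?thesis
          using m by (simp add: spine_point_def)
      qed
      show "spine_point (mean n u) j = u j"
        using out[of j] big by (cases "j = 0"; cases "j = 1")
          (auto simp: n spine_point_def m m[unfolded n One_nat_def])
    qed
  qed
qed

section \<open>Paths in a unique factorization category\<close>

text \<open>The starting object is an argument so that the empty string denotes an identity;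
  \<open>composite\<close> has no meaningful value there.\<close>

primrec path_comp :: "('o, 'm) category \<Rightarrow> 'o \<Rightarrow> 'm list \<Rightarrow> 'm" where
  "path_comp C a [] = Ident C a"
| "path_comp C a (f # fs) = Comp C (path_comp C (Cod C f) fs) f"

primrec is_path :: "('o, 'm) category \<Rightarrow> 'o \<Rightarrow> 'm list \<Rightarrow> bool" where
  "is_path C a [] \<longleftrightarrow> a \<in> Obj C"
| "is_path C a (f # fs) \<longleftrightarrow> f \<in> Mor C \<and> Dom C f = a \<and> is_path C (Cod C f) fs"

context category
begin

lemma path_comp_in:
  assumes "is_path C a fs"
  shows "path_comp C a fs \<in> Mor C" "Dom C (path_comp C a fs) = a" "a \<in> Obj C"
proof -
  have "path_comp C a fs \<in> Mor C \<and> Dom C (path_comp C a fs) = a \<and> a \<in> Obj C"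
    using assms
    by (induction fs arbitrary: a)
      (auto simp: ident_in_Mor dom_ident comp_in_Mor dom_comp dom_in_Obj)
  then show "path_comp C a fs \<in> Mor C" "Dom C (path_comp C a fs) = a" "a \<in> Obj C"
    by auto
qed

lemma Cod_path_comp_Cons:
  "is_path C a (f # fs) \<Longrightarrow> Cod C (path_comp C a (f # fs)) = Cod C (path_comp C (Cod C f) fs)"
  by (simp add: cod_comp path_comp_in)

lemma is_path_append:
  "is_path C a (xs @ ys) \<longleftrightarrow> is_path C a xs \<and> is_path C (Cod C (path_comp C a xs)) ys"
proof (induction xs arbitrary: a)
  case Nil
  have "a \<in> Obj C" if "is_path C a ys"
    using that by (rule path_comp_in(3))
  then show ?case
    by (auto simp: cod_ident)
next
  case (Cons f xs)
  show ?case
    using Cod_path_comp_Cons[of a f xs] by (auto simp: Cons.IH simp del: path_comp.simps)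
qed

lemma path_comp_append:
  "is_path C a (xs @ ys) \<Longrightarrow>
     path_comp C a (xs @ ys) = Comp C (path_comp C (Cod C (path_comp C a xs)) ys) (path_comp C a xs)"
proof (induction xs arbitrary: a)
  case Nil
  then show ?case
    using path_comp_in[of a ys] comp_ident_right[of "path_comp C a ys"] by (simp add: cod_ident)
next
  case (Cons f xs)
  have p: "is_path C (Cod C f) xs" "is_path C (Cod C (path_comp C (Cod C f) xs)) ys" "f \<in> Mor C"
    using Cons.prems by (auto simp: is_path_append)
  have cod: "Cod C (path_comp C a (f # xs)) = Cod C (path_comp C (Cod C f) xs)"
    using Cons.prems p by (intro Cod_path_comp_Cons) auto
  show ?case
    unfolding cod using Cons p path_comp_in[OF p(1)] path_comp_in[OF p(2)]
    by (simp add: comp_assoc)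
qed

lemma composable_is_path:
  "composable C (f # fs) \<Longrightarrow> is_path C (Dom C f) (f # fs) \<and> composite C (f # fs) = path_comp C (Dom C f) (f # fs)"
proof (induction fs arbitrary: f)
  case Nil
  then show ?case
    by (simp add: composable_def cod_in_Obj comp_ident_left)
next
  case (Cons g fs)
  have f: "f \<in> Mor C" "Cod C f = Dom C g" and "composable C (g # fs)"
    using Cons.prems by (auto simp: composable_def)
  with Cons.IH have "is_path C (Dom C g) (g # fs)" "composite C (g # fs) = path_comp C (Dom C g) (g # fs)"
    by blast+
  with f show ?case
    by simp
qed

lemma is_path_composable:
  "is_path C a (f # fs) \<Longrightarrow> composable C (f # fs)"
proof (induction fs arbitrary: a f)
  case Nil
  then show ?case
    by (simp add: composable_def)
next
  case (Cons g fs)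
  then have "composable C (g # fs)"
    by auto
  with Cons.prems show ?case
    by (simp add: composable_def)
qed

text \<open>Translates the nonempty composable strings of the definition into paths with a starting
  object, for which concatenation behaves well.\<close>

lemma factorization_iff:
  "factorization C f fs \<longleftrightarrow> fs \<noteq> [] \<and> is_path C (Dom C f) fs \<and> path_comp C (Dom C f) fs = f \<and>
     (\<forall>g\<in>set fs. non_identity C g \<and> indecomposable C g)"
proof (cases fs)
  case Nil
  then show ?thesis
    by (simp add: factorization_def composable_def)
next
  case (Cons g gs)
  have iff: "composable C fs \<longleftrightarrow> is_path C (Dom C g) fs"
    and eq: "composable C fs \<Longrightarrow> composite C fs = path_comp C (Dom C g) fs"
    using composable_is_path[of g gs] is_path_composable[of "Dom C g" g gs]
    unfolding Cons by blast+
  have dom: "Dom C g = Dom C f" if "is_path C (Dom C g) fs" "path_comp C (Dom C g) fs = f"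
    using path_comp_in(2)[OF that(1)] that(2) by simp
  have dom': "Dom C g = Dom C f" if "is_path C (Dom C f) fs"
    using that by (simp add: Cons)
  show ?thesis
  \<comment> \<open>If the domains differ, neither side holds: a path from \<open>Dom C f\<close>
    begins with a morphism out of it, and a composite has the domain of its first morphism.\<close>
  proof (cases "Dom C g = Dom C f")
    case True
    then show ?thesis
      unfolding factorization_def using iff eq Cons by auto
  next
    case False
    then have "\<not> is_path C (Dom C f) fs" "\<not> (composable C fs \<and> composite C fs = f)"
      using iff eq dom dom' by metis+
    then show ?thesis
      unfolding factorization_def by blast
  qed
qed

end

section \<open>Lists of irreducible factors\<close>

lemma (in finite_directed_category) ident_factors:
  assumes "f \<in> Mor C" "g \<in> Mor C" "Cod C f = Dom C g" "Comp C g f = Ident C a" "a \<in> Obj C"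
  shows "f = Ident C a"
proof -
  have f: "Dom C f = a" and g: "Cod C g = a"
    using dom_comp[OF assms(1-3)] cod_comp[OF assms(1-3)]
    unfolding assms(4) dom_ident[OF assms(5)] cod_ident[OF assms(5)] by simp_all
  \<comment> \<open>Otherwise \<open>f\<close> and \<open>g\<close> would run in opposite directions
    between two distinct objects.\<close>
  have "Cod C f = a"
  proof (rule ccontr)
    assume "Cod C f \<noteq> a"
    moreover have "f \<in> hom_set C a (Cod C f)" "g \<in> hom_set C (Cod C f) a"
      using assms f g by (auto simp: hom_set_def)
    ultimately show False
      using directed[of a "Cod C f"] assms(1,5) cod_in_Obj by blast
  qed
  then have "f \<in> hom_set C a a"
    using f assms(1) by (simp add: hom_set_def)
  then show ?thesis
    by (simp add: endo_trivial[OF assms(5)])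
qed

text \<open>Identities receive the empty list, which \<open>factorization\<close> excludes; with
  this value the lists concatenate under composition without exception.\<close>

definition factors :: "('o, 'm) category \<Rightarrow> 'm \<Rightarrow> 'm list" where
  "factors C f = (if f \<in> Ident C ` Obj C then [] else THE fs. factorization C f fs)"

context unique_factorization_category
begin

lemma factors_Ident [simp]: "a \<in> Obj C \<Longrightarrow> factors C (Ident C a) = []"
  by (simp add: factors_def)

lemma factors_path:
  assumes "f \<in> Mor C"
  shows "is_path C (Dom C f) (factors C f)" "path_comp C (Dom C f) (factors C f) = f"
    "\<forall>g\<in>set (factors C f). non_identity C g \<and> indecomposable C g"
proof -
  have "is_path C (Dom C f) (factors C f) \<and> path_comp C (Dom C f) (factors C f) = f \<and>
    (\<forall>g\<in>set (factors C f). non_identity C g \<and> indecomposable C g)"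
  proof (cases "f \<in> Ident C ` Obj C")
    case True
    then show ?thesis
      by (auto simp: dom_ident)
  next
    case False
    then have "factorization C f (factors C f)"
      using theI'[OF unique_factorization, of f] assms by (simp add: factors_def non_identity_def)
    then show ?thesis
      by (simp add: factorization_iff)
  qed
  then show "is_path C (Dom C f) (factors C f)" "path_comp C (Dom C f) (factors C f) = f"
    "\<forall>g\<in>set (factors C f). non_identity C g \<and> indecomposable C g"
    by auto
qed

lemma factors_eqI:
  assumes fs: "is_path C (Dom C f) fs" "path_comp C (Dom C f) fs = f"
    "\<forall>g\<in>set fs. non_identity C g \<and> indecomposable C g"
  shows "factors C f = fs"
proof (cases fs)
  case Nil
  then show ?thesis
    using fs factors_Ident[of "Dom C f"] by simp
next
  case (Cons g gs)
  have f: "f \<in> Mor C"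
    using path_comp_in(1)[OF fs(1)] fs(2) by simp
  \<comment> \<open>A nonempty string of non-identities cannot compose to an identity: by
    \<open>ident_factors\<close> its first member would be one.\<close>
  have "f \<notin> Ident C ` Obj C"
  proof
    assume "f \<in> Ident C ` Obj C"
    then obtain a where a: "a \<in> Obj C" "f = Ident C a"
      by blast
    have g: "g \<in> Mor C" "is_path C (Cod C g) gs"
      using fs(1) by (auto simp: Cons)
    have "Comp C (path_comp C (Cod C g) gs) g = Ident C a"
      using fs(2) a by (simp add: Cons)
    then have "g = Ident C a"
      by (rule ident_factors[OF g(1) path_comp_in(1)[OF g(2)] path_comp_in(2)[OF g(2), symmetric] _ a(1)])
    then show False
      using fs(3) a(1) by (simp add: Cons non_identity_def)
  qed
  then have "\<exists>!fs. factorization C f fs" "factors C f = (THE fs. factorization C f fs)"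
    using unique_factorization[of f] f by (auto simp: non_identity_def factors_def)
  moreover have "factorization C f fs"
    using fs Cons by (simp add: factorization_iff)
  ultimately show ?thesis
    by (simp add: the1_equality)
qed

text \<open>The concatenated list is a factorization of the composite, and uniqueness does the rest.
  This is the freeness of \<open>C\<close> on its irreducible morphisms.\<close>

lemma factors_Comp:
  assumes "f \<in> Mor C" "g \<in> Mor C" "Cod C f = Dom C g"
  shows "factors C (Comp C g f) = factors C f @ factors C g"
proof (rule factors_eqI)
  have dom: "Dom C (Comp C g f) = Dom C f"
    using assms by (rule dom_comp)
  show "is_path C (Dom C (Comp C g f)) (factors C f @ factors C g)"
    unfolding dom is_path_append using assms factors_path by auto
  then show "path_comp C (Dom C (Comp C g f)) (factors C f @ factors C g) = Comp C g f"
    unfolding dom using assms factors_path by (simp add: path_comp_append)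
  show "\<forall>h\<in>set (factors C f @ factors C g). non_identity C h \<and> indecomposable C h"
    using assms factors_path(3) by auto
qed

end

section \<open>Simplices of the nerve\<close>

lemma act_nerve_apply:
  "i \<le> m \<Longrightarrow> fst (act (nerve C) m n \<theta> F) i = fst F (\<theta> i)"
  "i \<le> j \<Longrightarrow> j \<le> m \<Longrightarrow> snd (act (nerve C) m n \<theta> F) (i, j) = snd F (\<theta> i, \<theta> j)"
  by (auto simp: nerve_def functor_comp_def ordinal_functor_def ordinal_category_def compose_def)

lemma (in category) nerve_simplexD:
  assumes "F \<in> simplices (nerve C) n"
  shows "i \<le> j \<Longrightarrow> j \<le> n \<Longrightarrow> snd F (i, j) \<in> Mor C"
    "i \<le> j \<Longrightarrow> j \<le> n \<Longrightarrow> Dom C (snd F (i, j)) = fst F i"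
    "i \<le> j \<Longrightarrow> j \<le> n \<Longrightarrow> Cod C (snd F (i, j)) = fst F j"
    "i \<le> n \<Longrightarrow> snd F (i, i) = Ident C (fst F i)"
    "i \<le> n \<Longrightarrow> fst F i \<in> Obj C"
    "\<lbrakk>i \<le> j; j \<le> k; k \<le> n\<rbrakk> \<Longrightarrow> snd F (i, k) = Comp C (snd F (j, k)) (snd F (i, j))"
  using assms mem_simplices_nerve[of "fst F" "snd F" C n] by auto

text \<open>The vertices are the domains of the edges \<open>(i, i)\<close>, so the morphism part
  determines the object part.\<close>

lemma (in category) nerve_simplex_eqI:
  assumes F: "F \<in> simplices (nerve C) n" and G: "G \<in> simplices (nerve C) n"
    and eq: "\<And>i j. i \<le> j \<Longrightarrow> j \<le> n \<Longrightarrow> snd F (i, j) = snd G (i, j)"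
  shows "F = G"
proof -
  obtain F\<^sub>0 F\<^sub>1 G\<^sub>0 G\<^sub>1 where FG: "F = (F\<^sub>0, F\<^sub>1)" "G = (G\<^sub>0, G\<^sub>1)"
    by fastforce
  have ext: "F\<^sub>0 \<in> extensional {..n}" "G\<^sub>0 \<in> extensional {..n}"
    "F\<^sub>1 \<in> extensional {(i, j). i \<le> j \<and> j \<le> n}" "G\<^sub>1 \<in> extensional {(i, j). i \<le> j \<and> j \<le> n}"
    using F G by (simp_all add: FG mem_simplices_nerve PiE_iff)
  have "fst F i = fst G i" if "i \<le> n" for i
    using nerve_simplexD(2)[OF F, of i i] nerve_simplexD(2)[OF G, of i i] eq[of i i] that by simp
  then have "F\<^sub>0 = G\<^sub>0"
    using ext by (intro extensionalityI) (auto simp: FG)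
  moreover have "F\<^sub>1 = G\<^sub>1"
    using ext eq by (intro extensionalityI) (auto simp: FG)
  ultimately show ?thesis
    by (simp add: FG)
qed

section \<open>The simplex spelled by the irreducible factors\<close>

definition vertex :: "('o, 'm) category \<Rightarrow> 'm \<Rightarrow> nat \<Rightarrow> 'o" where
  "vertex C f i = Cod C (path_comp C (Dom C f) (take i (factors C f)))"

abbreviation len :: "('o, 'm) category \<Rightarrow> 'm \<Rightarrow> nat" where
  "len C f \<equiv> length (factors C f)"

text \<open>The simplex \<open>G\<close> of the overview: its edge \<open>(i, j)\<close> composes
  the factors numbered \<open>i + 1\<close> to \<open>j\<close>.\<close>

definition full_simplex :: "('o, 'm) category \<Rightarrow> 'm \<Rightarrow> (nat, nat \<times> nat, 'o, 'm) cat_functor" where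
  "full_simplex C f = (\<lambda>i\<in>{..len C f}. vertex C f i,
     \<lambda>(i, j)\<in>{(i, j). i \<le> j \<and> j \<le> len C f}.
       path_comp C (vertex C f i) (take (j - i) (drop i (factors C f))))"

lemma snd_full_simplex:
  "i \<le> j \<Longrightarrow> j \<le> len C f \<Longrightarrow>
     snd (full_simplex C f) (i, j) = path_comp C (vertex C f i) (take (j - i) (drop i (factors C f)))"
  by (simp add: full_simplex_def)

context unique_factorization_category
begin

lemma vertex_path:
  assumes f: "f \<in> Mor C"
  shows "is_path C (vertex C f i) (take k (drop i (factors C f)))"
    "Cod C (path_comp C (vertex C f i) (take k (drop i (factors C f)))) = vertex C f (i + k)"
proof -
  have "is_path C (Dom C f) ((take i (factors C f) @ take k (drop i (factors C f))) @ drop (i + k) (factors C f))"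
    using factors_path(1)[OF f] by (metis append_take_drop_id take_add)
  then have p: "is_path C (Dom C f) (take i (factors C f) @ take k (drop i (factors C f)))"
    unfolding is_path_append[of _ "_ @ _"] by blast
  then show q: "is_path C (vertex C f i) (take k (drop i (factors C f)))"
    by (simp add: is_path_append vertex_def)
  have "Comp C (path_comp C (vertex C f i) (take k (drop i (factors C f)))) (path_comp C (Dom C f) (take i (factors C f)))
      = path_comp C (Dom C f) (take (i + k) (factors C f))"
    using path_comp_append[OF p] by (simp add: vertex_def take_add)
  moreover have "is_path C (Dom C f) (take i (factors C f))"
    using p by (simp add: is_path_append)
  note r = path_comp_in[OF this]
  ultimately show "Cod C (path_comp C (vertex C f i) (take k (drop i (factors C f)))) = vertex C f (i + k)"
    using cod_comp[OF r(1) path_comp_in(1)[OF q]] path_comp_in(2)[OF q] by (simp add: vertex_def)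
qed

text \<open>The composition law amounts to cutting the block of factors from \<open>i\<close> to
  \<open>k\<close> at \<open>j\<close>.\<close>

lemma full_simplex_in:
  assumes f: "f \<in> Mor C"
  shows "full_simplex C f \<in> simplices (nerve C) (len C f)"
proof -
  note vp = vertex_path[OF f]
  have comp: "path_comp C (vertex C f i) (take (k - i) (drop i (factors C f))) =
      Comp C (path_comp C (vertex C f j) (take (k - j) (drop j (factors C f))))
        (path_comp C (vertex C f i) (take (j - i) (drop i (factors C f))))"
    if "i \<le> j" "j \<le> k" for i j k
  proof -
    have "take (k - i) (drop i (factors C f)) =
        take (j - i) (drop i (factors C f)) @ take (k - j) (drop j (factors C f))"
      using that take_add[of "j - i" "k - j" "drop i (factors C f)"] by simp
    then show ?thesis
      using path_comp_append[of "vertex C f i" "take (j - i) (drop i (factors C f))"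
          "take (k - j) (drop j (factors C f))"] vp(1)[of i "k - i"] vp(2)[of i "j - i"] that
      by simp
  qed
  have mor: "path_comp C (vertex C f i) (take k (drop i (factors C f))) \<in> Mor C"
    "Dom C (path_comp C (vertex C f i) (take k (drop i (factors C f)))) = vertex C f i" for i k
    using path_comp_in[OF vp(1)] by auto
  have "vertex C f i \<in> Obj C" for i
    using path_comp_in(3)[OF vp(1)] .
  then show ?thesis
    unfolding full_simplex_def mem_simplices_nerve
    by (auto simp: mor vp(2) intro: comp)
qed

lemma vertex_mid:
  assumes "f \<in> Mor C" "k \<in> Mor C" "Dom C f = Dom C k" "factors C f = factors C k @ gs"
  shows "vertex C f (len C k) = Cod C k"
  using assms factors_path(2)[of k] by (simp add: vertex_def)

lemma factors_nerve:
  assumes F: "F \<in> simplices (nerve C) n" and ijk: "i \<le> j" "j \<le> k" "k \<le> n"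
  shows "factors C (snd F (i, k)) = factors C (snd F (i, j)) @ factors C (snd F (j, k))"
  unfolding nerve_simplexD(6)[OF F ijk]
  using nerve_simplexD(1-3)[OF F, of i j] nerve_simplexD(1-3)[OF F, of j k] ijk
  by (intro factors_Comp) auto

text \<open>The vertices of \<open>F\<close> cut the factor list of the long edge into blocks. The
  block between the positions of \<open>i\<close> and \<open>j\<close> is the factor list of
  \<open>F(i, j)\<close> and recomposes to it.\<close>

lemma full_simplex_segment:
  assumes F: "F \<in> simplices (nerve C) n" and ij: "i \<le> j" "j \<le> n"
  defines "f \<equiv> snd F (0, n)"
  shows "factors C f = factors C (snd F (0, i)) @ factors C (snd F (i, j)) @ factors C (snd F (j, n))"
    and "vertex C f (len C (snd F (0, i))) = fst F i"
    and "snd (full_simplex C f) (len C (snd F (0, i)), len C (snd F (0, j))) = snd F (i, j)"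
proof -
  note D = nerve_simplexD[OF F]
  have f1: "factors C f = factors C (snd F (0, i)) @ factors C (snd F (i, n))"
    unfolding f_def by (rule factors_nerve[OF F]) (use ij in auto)
  have f2: "factors C (snd F (i, n)) = factors C (snd F (i, j)) @ factors C (snd F (j, n))"
    by (rule factors_nerve[OF F ij order_refl])
  have f3: "factors C (snd F (0, j)) = factors C (snd F (0, i)) @ factors C (snd F (i, j))"
    by (rule factors_nerve[OF F]) (use ij in auto)
  show seg: "factors C f = factors C (snd F (0, i)) @ factors C (snd F (i, j)) @ factors C (snd F (j, n))"
    by (simp add: f1 f2)
  show v: "vertex C f (len C (snd F (0, i))) = fst F i"
    using vertex_mid[of f "snd F (0, i)"] f1 D(1-3)[of 0 i] D(1,2)[of 0 n] ij by (simp add: f_def)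
  have "snd (full_simplex C f) (len C (snd F (0, i)), len C (snd F (0, j))) =
      path_comp C (fst F i) (factors C (snd F (i, j)))"
    by (subst snd_full_simplex) (simp_all add: v f3, simp_all add: seg)
  also have "\<dots> = snd F (i, j)"
    using factors_path(2)[of "snd F (i, j)"] D(1,2)[OF ij] by simp
  finally show "snd (full_simplex C f) (len C (snd F (0, i)), len C (snd F (0, j))) = snd F (i, j)" .
qed

definition "position n F = (\<lambda>i\<in>{..n}. len C (snd F (0, i)))"

lemma position_monotone:
  assumes F: "F \<in> simplices (nerve C) n"
  shows "position n F \<in> monotone_maps n (len C (snd F (0, n)))"
proof -
  have "len C (snd F (0, i)) \<le> len C (snd F (0, j))" if "i \<le> j" "j \<le> n" for i j
    using factors_nerve[OF F, of 0 i j] that by simp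
  then show ?thesis
    by (auto simp: monotone_maps_def position_def monotone_on_def)
qed

text \<open>Equality may be tested on edges, where it is \<open>full_simplex_segment\<close>. Thus
  every simplex is a restriction of the full simplex of its long edge.\<close>

lemma act_position:
  assumes F: "F \<in> simplices (nerve C) n"
  defines "f \<equiv> snd F (0, n)"
  shows "act (nerve C) n (len C f) (position n F) (full_simplex C f) = F"
proof -
  interpret N: simplicial_set "nerve C"
    by (rule simplicial_set_nerve)
  have f: "f \<in> Mor C"
    unfolding f_def using nerve_simplexD(1)[OF F] by simp
  show ?thesis
  proof (rule nerve_simplex_eqI[OF N.act_in F])
    show "position n F \<in> monotone_maps n (len C f)"
      unfolding f_def by (rule position_monotone[OF F])
    show "snd (act (nerve C) n (len C f) (position n F) (full_simplex C f)) (i, j) = snd F (i, j)"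
      if "i \<le> j" "j \<le> n" for i j
      using full_simplex_segment(3)[OF F that] that
      by (simp add: act_nerve_apply position_def f_def)
  qed (rule full_simplex_in[OF f])
qed

definition "shift m a = (\<lambda>i\<in>{..m}. i + a)" for m a :: nat

lemma shift_monotone: "a + m \<le> n \<Longrightarrow> shift m a \<in> monotone_maps m n"
  by (auto simp: shift_def monotone_maps_def monotone_on_def)

text \<open>The factors of \<open>g\<close> form a contiguous block of those of \<open>f\<close>,
  beginning after the first \<open>a\<close>. Hence passing to a smaller simplex changes the full
  simplex only by an interval inclusion.\<close>

lemma full_simplex_shift:
  assumes F: "F \<in> simplices (nerve C) n" and ij: "i \<le> j" "j \<le> n"
  defines "f \<equiv> snd F (0, n)" and "g \<equiv> snd F (i, j)" and "a \<equiv> len C (snd F (0, i))"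
  shows "full_simplex C g = act (nerve C) (len C g) (len C f) (shift (len C g) a) (full_simplex C f)"
    and "a + len C g \<le> len C f"
proof -
  interpret N: simplicial_set "nerve C"
    by (rule simplicial_set_nerve)
  have fg: "f \<in> Mor C" "g \<in> Mor C"
    unfolding f_def g_def using nerve_simplexD(1)[OF F] ij by auto
  have fac: "factors C f = factors C (snd F (0, i)) @ factors C g @ factors C (snd F (j, n))"
    unfolding f_def g_def by (rule full_simplex_segment(1)[OF F ij])
  show le: "a + len C g \<le> len C f"
    by (simp add: fac a_def)
  have v: "vertex C f a = Dom C g"
    unfolding f_def a_def g_def using full_simplex_segment(2)[OF F ij] nerve_simplexD(2)[OF F ij] by simp
  have vv: "vertex C f (a + k) = vertex C g k" if "k \<le> len C g" for k
    using vertex_path(2)[OF fg(1), of a k] that by (simp add: v[unfolded a_def] vertex_def[of C g] fac a_def)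
  show "full_simplex C g = act (nerve C) (len C g) (len C f) (shift (len C g) a) (full_simplex C f)"
  proof (rule nerve_simplex_eqI[OF full_simplex_in[OF fg(2)] N.act_in])
    show "shift (len C g) a \<in> monotone_maps (len C g) (len C f)"
      using le by (rule shift_monotone)
    show "snd (full_simplex C g) (k, l) =
        snd (act (nerve C) (len C g) (len C f) (shift (len C g) a) (full_simplex C f)) (k, l)"
      if "k \<le> l" "l \<le> len C g" for k l
      using that vv[of k] le
      by (simp add: act_nerve_apply shift_def snd_full_simplex add.commute[of _ a])
        (simp add: fac a_def)
  qed (rule full_simplex_in[OF fg(1)])
qed

end

section \<open>The simplicial subset of vertices and irreducible edges\<close>

text \<open>Its realization is the graph of objects and non-identity indecomposable morphisms:
  identities have length 0, and length 1 means a single irreducible factor.\<close>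

definition quiver_nerve :: "('o, 'm) category \<Rightarrow> (nat, nat \<times> nat, 'o, 'm) cat_functor sset" where
  "quiver_nerve C =
     (nerve C)\<lparr>simplices := \<lambda>n. {F \<in> simplices (nerve C) n. len C (snd F (0, n)) \<le> 1}\<rparr>"

lemma act_quiver_nerve [simp]: "act (quiver_nerve C) = act (nerve C)"
  by (simp add: quiver_nerve_def)

lemma mem_quiver_nerve:
  "F \<in> simplices (quiver_nerve C) n \<longleftrightarrow> F \<in> simplices (nerve C) n \<and> len C (snd F (0, n)) \<le> 1"
  by (simp add: quiver_nerve_def)

lemma monotone_mapsD:
  assumes "\<theta> \<in> monotone_maps m n"
  shows "i \<le> m \<Longrightarrow> \<theta> i \<le> n" "i \<le> j \<Longrightarrow> j \<le> m \<Longrightarrow> \<theta> i \<le> \<theta> j"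
  using assms by (auto simp: monotone_maps_def monotone_on_def PiE_iff)

context unique_factorization_category
begin

sublocale nerve: simplicial_set "nerve C"
  by (rule simplicial_set_nerve)

sublocale quiver_nerve: simplicial_set "quiver_nerve C"
proof
  fix \<theta> m n F
  assume \<theta>: "\<theta> \<in> monotone_maps m n" and F: "F \<in> simplices (quiver_nerve C) n"
  then have F': "F \<in> simplices (nerve C) n"
    by (simp add: mem_quiver_nerve)
  \<comment> \<open>The long edge of the restricted simplex is a segment of the long edge of
    \<open>F\<close>, so its factors form a block of the whole list.\<close>
  have "len C (snd F (\<theta> 0, \<theta> m)) \<le> len C (snd F (0, n))"
    using full_simplex_segment(1)[OF F', of "\<theta> 0" "\<theta> m"] monotone_mapsD[OF \<theta>] by simp
  with F show "act (quiver_nerve C) m n \<theta> F \<in> simplices (quiver_nerve C) m"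
    using nerve.act_in[OF \<theta> F'] by (simp add: mem_quiver_nerve act_nerve_apply)
qed (auto simp: mem_quiver_nerve nerve.act_id nerve.act_comp)

lemma simplicial_subset_quiver_nerve: "simplicial_subset (quiver_nerve C) (nerve C)"
  using quiver_nerve.simplicial_set_axioms by (auto simp: simplicial_subset_def mem_quiver_nerve)

text \<open>With at most one factor in all, two neighbours among the vertices 0, 1, 2 have the same
  position. The edge between them is an identity and can be collapsed.\<close>

lemma degenerate_quiver_nerve:
  assumes F: "F \<in> simplices (quiver_nerve C) n" and n: "1 < n"
  shows "degenerate (quiver_nerve C) n F"
proof -
  have F': "F \<in> simplices (nerve C) n" and N: "len C (snd F (0, n)) \<le> 1"
    using F by (auto simp: mem_quiver_nerve)
  define p where "p i = len C (snd F (0, i))" for i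
  have "p 0 \<le> p 1" "p 1 \<le> p 2" "p 2 \<le> 1"
    using factors_nerve[OF F', of 0 0 1] factors_nerve[OF F', of 0 1 2]
      factors_nerve[OF F', of 0 2 n] n N by (auto simp: p_def)
  then have "p 0 = p 1 \<or> p 1 = p 2"
    by linarith
  then have "\<exists>i. Suc i \<le> n \<and> p i = p (Suc i)"
    using n by (metis One_nat_def Suc_1 Suc_leI less_imp_le_nat)
  then obtain i where i: "Suc i \<le> n" "p i = p (Suc i)"
    by blast
  obtain k where k: "n = Suc k" "i \<le> k"
    using i(1) by (cases n) auto
  \<comment> \<open>The face that omits vertex \<open>i + 1\<close>. Composed with the codegeneracy
    it sends \<open>i + 1\<close> to \<open>i\<close> and fixes all other vertices, so positions are
    preserved.\<close>
  define d where "d = (\<lambda>j\<in>{..k}. if j \<le> i then j else Suc j)"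
  have d: "d \<in> monotone_maps k n"
    by (auto simp: d_def monotone_maps_def monotone_on_def k)
  have c: "codegeneracy k i \<in> monotone_maps n k"
    using k by (auto simp: codegeneracy_def monotone_maps_def monotone_on_def)
  define e where "e j = d (codegeneracy k i j)" for j
  have e: "e j = (if j = Suc i then i else j)" if "j \<le> n" for j
    using that k by (auto simp: e_def d_def codegeneracy_def)
  have pe: "p (e j) = p j" if "j \<le> n" for j
    using that i(2) by (simp add: e)
  \<comment> \<open>An edge of \<open>F\<close> depends only on the positions of its ends, being the
    corresponding edge of the full simplex.\<close>
  have "snd F (a, b) = snd F (e a, e b)" if ab: "a \<le> b" "b \<le> n" for a b
  proof -
    have "e a \<le> e b" "e b \<le> n"
      using ab by (auto simp: e)
    then show ?thesis
      using full_simplex_segment(3)[OF F' ab] full_simplex_segment(3)[OF F', of "e a" "e b"]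
        pe[of a] pe[of b] ab by (simp add: p_def)
  qed
  then have eq: "F = act (quiver_nerve C) n k (codegeneracy k i) (act (nerve C) k n d F)"
    using monotone_mapsD[OF c] unfolding act_quiver_nerve
    by (intro nerve_simplex_eqI[OF F' nerve.act_in[OF c nerve.act_in[OF d F']]])
      (simp add: act_nerve_apply e_def)
  have "act (nerve C) k n d F \<in> simplices (quiver_nerve C) k"
    using quiver_nerve.act_in[OF d F] by simp
  then show ?thesis
    unfolding degenerate_def by (intro exI conjI) (rule k | assumption | rule eq)+
qed

text \<open>A block of irreducible morphisms is the factorization of its own composite.\<close>

lemma factors_full_simplex:
  assumes f: "f \<in> Mor C" and ij: "i \<le> j" "j \<le> len C f"
  shows "factors C (snd (full_simplex C f) (i, j)) = take (j - i) (drop i (factors C f))"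
proof -
  note p = vertex_path(1)[OF f, of i "j - i"]
  have "\<forall>g\<in>set (take (j - i) (drop i (factors C f))). non_identity C g \<and> indecomposable C g"
    using factors_path(3)[OF f] by (meson in_set_dropD in_set_takeD)
  then show ?thesis
    unfolding snd_full_simplex[OF ij] using p path_comp_in(2)[OF p] by (intro factors_eqI) auto
qed

text \<open>An edge of the spine has one factor, or none where \<open>edge_map\<close> is truncated
  at the end.\<close>

lemma edge_in_quiver_nerve:
  assumes f: "f \<in> Mor C"
  shows "act (nerve C) 1 (len C f) (edge_map (len C f) j) (full_simplex C f) \<in> simplices (quiver_nerve C) 1"
proof -
  have "snd (act (nerve C) 1 (len C f) (edge_map (len C f) j) (full_simplex C f)) (0, 1) =
      snd (full_simplex C f) (min j (len C f), min (Suc j) (len C f))"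
    by (simp add: act_nerve_apply edge_map_def)
  then have "len C (snd (act (nerve C) 1 (len C f) (edge_map (len C f) j) (full_simplex C f)) (0, 1)) \<le> 1"
    by (simp add: factors_full_simplex[OF f])
  then show ?thesis
    using nerve.act_in[OF edge_map_monotone full_simplex_in[OF f]] by (simp add: mem_quiver_nerve)
qed

section \<open>The straight-line deformation onto the spine\<close>

definition coords where
  "coords n F t = simplex_push n (position n F) t"

text \<open>The distance along the spine at which the point will arrive: the number of factors of
  \<open>F(0, i)\<close>, averaged with the weights \<open>t i\<close>.\<close>

definition height where
  "height n F t = mean (len C (snd F (0, n))) (coords n F t)"

lemma coords_in_standard_simplex:
  assumes "F \<in> simplices (nerve C) n" "t \<in> standard_simplex n"
  shows "coords n F t \<in> standard_simplex (len C (snd F (0, n)))"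
  unfolding coords_def using assms position_monotone simplex_push_in_standard_simplex by blast

lemma height_bounds:
  assumes "F \<in> simplices (nerve C) n" "t \<in> standard_simplex n"
  shows "0 \<le> height n F t" "height n F t \<le> real (len C (snd F (0, n)))"
  unfolding height_def using mean_bounds[OF coords_in_standard_simplex[OF assms]] by auto

text \<open>By \<open>act_position\<close> this is the gluing relation along
  \<open>position n F\<close>.\<close>

lemma realization_point_coords:
  assumes F: "F \<in> simplices (nerve C) n" and t: "t \<in> standard_simplex n"
  shows "realization_point (nerve C) (len C (snd F (0, n))) (full_simplex C (snd F (0, n))) (coords n F t)
    = realization_point (nerve C) n F t"
  using nerve.realization_point_act[OF position_monotone[OF F] full_simplex_in t]
    nerve_simplexD(1)[OF F, of 0 n] act_position[OF F] by (simp add: coords_def)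

text \<open>Counting factors from vertex 0 instead of vertex \<open>\<theta> 0\<close> adds the
  constant number of factors of the edge \<open>(0, \<theta> 0)\<close>.\<close>

lemma coords_act:
  assumes F: "F \<in> simplices (nerve C) n" and \<theta>: "\<theta> \<in> monotone_maps m n"
  shows "coords n F (simplex_push m \<theta> t) =
    simplex_push (len C (snd F (\<theta> 0, \<theta> m))) (\<lambda>k. k + len C (snd F (0, \<theta> 0)))
      (coords m (act (nerve C) m n \<theta> F) t)"
proof -
  let ?F' = "act (nerve C) m n \<theta> F"
  note \<theta>D = monotone_mapsD[OF \<theta>]
  have pos: "position n F (\<theta> k) = position m ?F' k + len C (snd F (0, \<theta> 0))" if "k \<le> m" for k
    using factors_nerve[OF F, of 0 "\<theta> 0" "\<theta> k"] \<theta>D[of k] \<theta>D(2)[of 0 k] that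
    by (simp add: position_def act_nerve_apply)
  have bound: "position m ?F' k \<le> len C (snd F (\<theta> 0, \<theta> m))" if "k \<le> m" for k
    using factors_nerve[OF F, of "\<theta> 0" "\<theta> k" "\<theta> m"] \<theta>D(1)[of m] \<theta>D(2)[of 0 k] \<theta>D(2)[of k m] that
    by (simp add: position_def act_nerve_apply)
  show ?thesis
    unfolding coords_def using \<theta>D(1) bound
    by (simp add: simplex_push_compose pos cong: simplex_push_cong)
qed

lemma height_act:
  assumes F: "F \<in> simplices (nerve C) n" and \<theta>: "\<theta> \<in> monotone_maps m n" and t: "t \<in> standard_simplex m"
  shows "height n F (simplex_push m \<theta> t) =
    height m (act (nerve C) m n \<theta> F) t + real (len C (snd F (0, \<theta> 0)))"
proof -
  note \<theta>D = monotone_mapsD[OF \<theta>]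
  have "len C (snd F (0, \<theta> 0)) + len C (snd F (\<theta> 0, \<theta> m)) \<le> len C (snd F (0, n))"
    using full_simplex_shift(2)[OF F \<theta>D(2)[of 0 m] \<theta>D(1)[of m]] by simp
  then show ?thesis
    using coords_in_standard_simplex[OF nerve.act_in[OF \<theta> F] t]
    by (simp add: height_def coords_act[OF F \<theta>] mean_shift act_nerve_apply)
qed

lemma full_simplex_act:
  assumes F: "F \<in> simplices (nerve C) n" and \<theta>: "\<theta> \<in> monotone_maps m n"
  defines "f \<equiv> snd F (0, n)" and "g \<equiv> snd F (\<theta> 0, \<theta> m)" and "a \<equiv> len C (snd F (0, \<theta> 0))"
  shows "full_simplex C g = act (nerve C) (len C g) (len C f) (shift (len C g) a) (full_simplex C f)"
    "shift (len C g) a \<in> monotone_maps (len C g) (len C f)" "a + len C g \<le> len C f"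
  using full_simplex_shift[OF F monotone_mapsD(2)[OF \<theta>, of 0 m] monotone_mapsD(1)[OF \<theta>, of m]]
  by (auto simp: f_def g_def a_def intro: shift_monotone)

lemma continuous_map_coords:
  assumes "continuous_map K (powertop_real UNIV) t"
  shows "continuous_map K (powertop_real UNIV) (\<lambda>k. coords n F (t k))"
    "continuous_map K euclideanreal (\<lambda>k. height n F (t k))"
proof -
  show c: "continuous_map K (powertop_real UNIV) (\<lambda>k. coords n F (t k))"
    unfolding coords_def by (rule continuous_map_simplex_push[OF assms])
  show "continuous_map K euclideanreal (\<lambda>k. height n F (t k))"
    unfolding height_def by (rule continuous_map_mean[OF c])
qed

definition slide :: "real \<Rightarrow> nat \<Rightarrow> (nat, nat \<times> nat, 'o, 'm) cat_functor \<Rightarrow> (nat \<Rightarrow> real) \<Rightarrow> nat \<Rightarrow> real" where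
  "slide s n F t = (\<lambda>j. (1 - s) * coords n F t j + s * spine_point (height n F t) j)"

lemma slide_in_standard_simplex:
  assumes "F \<in> simplices (nerve C) n" "t \<in> standard_simplex n" "0 \<le> s" "s \<le> 1"
  shows "slide s n F t \<in> standard_simplex (len C (snd F (0, n)))"
  unfolding slide_def using assms height_bounds[OF assms(1,2)]
  by (intro convex_standard_simplex coords_in_standard_simplex spine_point_in_standard_simplex)

text \<open>The shift acts affinely and carries both ends of the segment, the original point and the
  spine point, to their counterparts in the larger simplex.\<close>

lemma slide_act:
  assumes F: "F \<in> simplices (nerve C) n" and \<theta>: "\<theta> \<in> monotone_maps m n" and t: "t \<in> standard_simplex m"
  shows "slide s n F (simplex_push m \<theta> t) =
    simplex_push (len C (snd F (\<theta> 0, \<theta> m))) (\<lambda>k. k + len C (snd F (0, \<theta> 0)))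
      (slide s m (act (nerve C) m n \<theta> F) t)"
  using height_bounds[OF nerve.act_in[OF \<theta> F] t]
  by (simp add: slide_def simplex_push_convex coords_act[OF F \<theta>] height_act[OF assms]
      simplex_push_spine_point act_nerve_apply)

definition deform where
  "deform s n F t = realization_point (nerve C) (len C (snd F (0, n))) (full_simplex C (snd F (0, n)))
     (slide s n F t)"

text \<open>The full simplex of the restricted simplex is a restriction along a shift, and
  \<open>slide\<close> moves by the same shift, so the two points are glued.\<close>

lemma deform_act:
  assumes F: "F \<in> simplices (nerve C) n" and \<theta>: "\<theta> \<in> monotone_maps m n" and t: "t \<in> standard_simplex m"
    and s: "0 \<le> s" "s \<le> 1"
  shows "deform s m (act (nerve C) m n \<theta> F) t = deform s n F (simplex_push m \<theta> t)"
proof -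
  let ?F' = "act (nerve C) m n \<theta> F"
  let ?f = "snd F (0, n)" and ?g = "snd F (\<theta> 0, \<theta> m)" and ?a = "len C (snd F (0, \<theta> 0))"
  note G = full_simplex_act[OF F \<theta>]
  have f: "?f \<in> Mor C"
    using nerve_simplexD(1)[OF F] by simp
  have g: "snd ?F' (0, m) = ?g"
    by (simp add: act_nerve_apply)
  have "deform s m ?F' t = realization_point (nerve C) (len C ?f) (full_simplex C ?f)
      (simplex_push (len C ?g) (shift (len C ?g) ?a) (slide s m ?F' t))"
    unfolding deform_def g G(1)
    using slide_in_standard_simplex[OF nerve.act_in[OF \<theta> F] t s]
    by (intro nerve.realization_point_act[OF G(2) full_simplex_in[OF f]]) (simp add: g)
  also have "simplex_push (len C ?g) (shift (len C ?g) ?a) (slide s m ?F' t) =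
      slide s n F (simplex_push m \<theta> t)"
    unfolding slide_act[OF F \<theta> t] by (rule simplex_push_cong) (simp add: shift_def)
  finally show ?thesis
    by (simp add: deform_def)
qed

lemma continuous_map_deform:
  assumes F: "F \<in> simplices (nerve C) n"
  shows "continuous_map (prod_topology (top_of_set {0..1}) (simplex_space n))
    (geometric_realization (nerve C)) (\<lambda>(s, t). deform s n F t)"
proof -
  let ?K = "prod_topology (top_of_set {0..1::real}) (simplex_space n)"
  have f: "snd F (0, n) \<in> Mor C"
    using nerve_simplexD(1)[OF F] by simp
  have fst: "continuous_map ?K euclideanreal fst"
    using continuous_map_fst continuous_map_into_fulltopology by blast
  have snd: "continuous_map ?K (powertop_real UNIV) snd"
    using continuous_map_snd continuous_map_into_fulltopology by blast
  note c = continuous_map_coords[OF snd, of n F]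
  have "continuous_map ?K euclideanreal (\<lambda>k. coords n F (snd k) j)" for j
    using c(1) by (simp add: continuous_map_componentwise_UNIV)
  then have "continuous_map ?K (powertop_real UNIV) (\<lambda>k. slide (fst k) n F (snd k))"
    unfolding slide_def spine_point_def continuous_map_componentwise_UNIV
    by (intro allI continuous_intros fst c(2)) auto
  then have "continuous_map ?K (simplex_space (len C (snd F (0, n)))) (\<lambda>k. slide (fst k) n F (snd k))"
    using slide_in_standard_simplex[OF F] by (auto simp: continuous_map_in_subtopology)
  from continuous_map_compose[OF this continuous_map_realization_point[OF full_simplex_in[OF f]]]
  show ?thesis
    by (simp add: o_def case_prod_unfold deform_def)
qed

text \<open>Lifts the end of the deformation. The spine point lies on the edge numbered by the
  integer part of the height; this edge belongs to \<open>quiver_nerve C\<close>, so the value can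
  be taken in the realization of the subset.\<close>

definition spine_retract where
  "spine_retract n F t = realization_point (quiver_nerve C) 1
     (act (nerve C) 1 (len C (snd F (0, n)))
       (edge_map (len C (snd F (0, n))) (nat \<lfloor>height n F t\<rfloor>)) (full_simplex C (snd F (0, n))))
     (edge_point (frac (height n F t)))"

text \<open>At an integer height two neighbouring edges compete. Their endpoints are glued, within
  the subset, to the common vertex regarded as a 0-simplex.\<close>

lemma edge_point_vertex:
  assumes G: "G \<in> simplices (nerve C) N" and \<alpha>: "\<alpha> \<in> monotone_maps 1 N" and \<beta>: "\<beta> \<in> monotone_maps 1 N"
    and in_Y: "act (nerve C) 1 N \<alpha> G \<in> simplices (quiver_nerve C) 1"
      "act (nerve C) 1 N \<beta> G \<in> simplices (quiver_nerve C) 1"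
    and ij: "i \<le> 1" "j \<le> 1" "\<alpha> i = \<beta> j"
  shows "realization_point (quiver_nerve C) 1 (act (nerve C) 1 N \<alpha> G) (edge_point (real i)) =
    realization_point (quiver_nerve C) 1 (act (nerve C) 1 N \<beta> G) (edge_point (real j))"
proof -
  define v where "v = (\<lambda>j::nat. if j = 0 then 1 else 0 :: real)"
  have v: "v \<in> standard_simplex 0"
    by (simp add: v_def standard_simplex_0)
  have vertex: "realization_point (quiver_nerve C) 1 (act (nerve C) 1 N \<gamma> G) (edge_point (real l)) =
      realization_point (quiver_nerve C) 0 (act (nerve C) 0 N (\<lambda>_\<in>{..0}. \<gamma> l) G) v"
    if \<gamma>: "\<gamma> \<in> monotone_maps 1 N" "act (nerve C) 1 N \<gamma> G \<in> simplices (quiver_nerve C) 1" and l: "l \<le> 1"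
    for \<gamma> l
  proof -
    let ?\<delta> = "\<lambda>_\<in>{..0::nat}. l"
    have \<delta>: "?\<delta> \<in> monotone_maps 0 1"
      using l by (auto simp: monotone_maps_def monotone_on_def)
    have "simplex_push 0 ?\<delta> v = edge_point (real l)"
      using l by (auto simp: simplex_push_def edge_point_def v_def fun_eq_iff le_Suc_eq)
    moreover have "compose {..0} \<gamma> ?\<delta> = (\<lambda>_\<in>{..0}. \<gamma> l)"
      by (auto simp: compose_def)
    ultimately show ?thesis
      using quiver_nerve.realization_point_act[OF \<delta> \<gamma>(2) v] nerve.act_comp[OF \<delta> \<gamma>(1) G] by simp
  qed
  show ?thesis
    using vertex[OF \<alpha> in_Y(1) ij(1)] vertex[OF \<beta> in_Y(2) ij(2)] ij(3) by simp
qed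

text \<open>Restriction changes the height by an integer, which renumbers the edge but keeps the
  position on it. The two chosen edges can differ only at the right end of the smaller full
  simplex.\<close>

lemma spine_retract_act:
  assumes F: "F \<in> simplices (nerve C) n" and \<theta>: "\<theta> \<in> monotone_maps m n" and t: "t \<in> standard_simplex m"
  shows "spine_retract m (act (nerve C) m n \<theta> F) t = spine_retract n F (simplex_push m \<theta> t)"
proof -
  let ?F' = "act (nerve C) m n \<theta> F"
  let ?f = "snd F (0, n)" and ?g = "snd F (\<theta> 0, \<theta> m)" and ?a = "len C (snd F (0, \<theta> 0))"
  define x where "x = height m ?F' t"
  define j where "j = nat \<lfloor>x\<rfloor>"
  note G = full_simplex_act[OF F \<theta>]
  have f: "?f \<in> Mor C" and g': "?g \<in> Mor C"
    using nerve_simplexD(1)[OF F] monotone_mapsD[OF \<theta>] by auto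
  have g: "snd ?F' (0, m) = ?g"
    by (simp add: act_nerve_apply)
  have x: "0 \<le> x" "x \<le> real (len C ?g)"
    using height_bounds[OF nerve.act_in[OF \<theta> F] t] by (simp_all add: x_def g)
  have xj: "x = real j + frac x"
    using x by (simp add: j_def frac_def)
  have height: "height n F (simplex_push m \<theta> t) = x + real ?a"
    unfolding x_def by (rule height_act[OF assms])
  have ja: "nat \<lfloor>x + real ?a\<rfloor> = j + ?a" "frac (x + real ?a) = frac x"
    using x by (simp_all add: j_def nat_add_distrib frac_def)
  \<comment> \<open>The selected edge of the smaller full simplex, seen in the larger one.\<close>
  define \<alpha> where "\<alpha> = compose {..1} (shift (len C ?g) ?a) (edge_map (len C ?g) j)"
  have \<alpha>_eq: "\<alpha> i = min (j + i) (len C ?g) + ?a" if "i \<le> 1" for i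
    using that by (simp add: \<alpha>_def compose_def shift_def edge_map_def)
  have \<alpha>_ext: "\<alpha> \<in> extensional {..1}"
    by (simp add: \<alpha>_def compose_def)
  have "\<alpha> i \<le> len C ?f" if "i \<le> 1" for i
    unfolding \<alpha>_eq[OF that] using G(3) by linarith
  moreover have "\<alpha> i \<le> \<alpha> k" if "i \<le> k" "k \<le> 1" for i k
    unfolding \<alpha>_eq[OF that(2)] \<alpha>_eq[OF order_trans[OF that]] using that(1) by linarith
  ultimately have \<alpha>: "\<alpha> \<in> monotone_maps 1 (len C ?f)"
    using \<alpha>_ext by (simp add: monotone_maps_def monotone_on_def PiE_iff)
  have act_\<alpha>: "act (nerve C) 1 (len C ?g) (edge_map (len C ?g) j) (full_simplex C ?g) =
      act (nerve C) 1 (len C ?f) \<alpha> (full_simplex C ?f)"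
    unfolding \<alpha>_def G(1) by (rule nerve.act_comp[OF edge_map_monotone G(2) full_simplex_in[OF f], symmetric])
  have "realization_point (quiver_nerve C) 1 (act (nerve C) 1 (len C ?f) \<alpha> (full_simplex C ?f))
      (edge_point (frac x)) =
    realization_point (quiver_nerve C) 1
      (act (nerve C) 1 (len C ?f) (edge_map (len C ?f) (j + ?a)) (full_simplex C ?f))
      (edge_point (frac x))"
  proof (cases "j < len C ?g")
    case True
    have "\<alpha> = edge_map (len C ?f) (j + ?a)"
    proof (rule extensionalityI[OF \<alpha>_ext])
      show "\<alpha> i = edge_map (len C ?f) (j + ?a) i" if "i \<in> {..1}" for i
        using that True G(3) by (simp add: \<alpha>_eq edge_map_def)
    qed (simp add: edge_map_def)
    then show ?thesis
      by simp
  next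
    \<comment> \<open>Here \<open>x\<close> is the length of the smaller full simplex:
      \<open>\<alpha>\<close> is constant, while the edge of the larger one may go on. As
      \<open>frac x = 0\<close>, only their common initial vertex counts.\<close>
    case False
    then have "frac x = 0" "j = len C ?g"
      using x xj frac_ge_0[of x] by linarith+
    then have "\<alpha> 0 = edge_map (len C ?f) (j + ?a) 0"
      using \<alpha>_eq[of 0] G(3) by (simp add: edge_map_def)
    from edge_point_vertex[OF full_simplex_in[OF f] \<alpha> edge_map_monotone
        edge_in_quiver_nerve[OF g', of j, unfolded act_\<alpha>] edge_in_quiver_nerve[OF f] _ _ this]
    show ?thesis
      by (simp add: \<open>frac x = 0\<close>)
  qed
  then show ?thesis
    unfolding spine_retract_def g height ja x_def[symmetric] j_def[symmetric] act_\<alpha> .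
qed

text \<open>The integer part jumps, but on the closed set of heights between \<open>j\<close> and
  \<open>j + 1\<close> the formula with the fixed edge \<open>j\<close> is continuous. These
  finitely many pieces agree where they meet.\<close>

lemma continuous_map_spine_retract:
  assumes F: "F \<in> simplices (nerve C) n"
  shows "continuous_map (simplex_space n) (geometric_realization (quiver_nerve C)) (spine_retract n F)"
proof -
  let ?f = "snd F (0, n)"
  let ?N = "len C ?f"
  have f: "?f \<in> Mor C"
    using nerve_simplexD(1)[OF F] by simp
  define T where "T j = {t \<in> standard_simplex n. height n F t \<in> {real j..real j + 1}}" for j
  define E where "E j = act (nerve C) 1 ?N (edge_map ?N j) (full_simplex C ?f)" for j
  define r where "r j t = realization_point (quiver_nerve C) 1 (E j) (edge_point (height n F t - real j))" for j t
  have E: "E j \<in> simplices (quiver_nerve C) 1" for j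
    unfolding E_def by (rule edge_in_quiver_nerve[OF f])
  have h: "continuous_map (simplex_space n) euclideanreal (height n F)"
    using continuous_map_coords(2)[OF continuous_map_from_subtopology[OF continuous_map_id]]
    by simp
  \<comment> \<open>Distinct pieces meet only at height \<open>j = i + 1\<close>, where edge
    \<open>i\<close> ends and edge \<open>j\<close> begins.\<close>
  have agree: "r i t = r j t" if "i \<le> j" "j \<le> ?N" "t \<in> T i" "t \<in> T j" for i j t
  proof (cases "i = j")
    case False
    then have "height n F t = real j" "j = Suc i"
      using that by (auto simp: T_def)
    then show ?thesis
      using edge_point_vertex[OF full_simplex_in[OF f] edge_map_monotone edge_map_monotone
          E[of i, unfolded E_def] E[of j, unfolded E_def], of 1 0] that(2)
      by (simp add: r_def E_def edge_map_def)
  qed simp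
  show ?thesis
  \<comment> \<open>The index \<open>?N\<close> is included because the integer part takes this
    value at height \<open>?N\<close>; the edge there is constant.\<close>
  proof (rule pasting_lemma_closed[where I = "{..?N}" and T = T and f = r])
    show "closedin (simplex_space n) (T j)" if "j \<in> {..?N}" for j
      using closedin_continuous_map_preimage[OF h, of "{real j..real j + 1}"] by (simp add: T_def)
    show "continuous_map (subtopology (simplex_space n) (T j)) (geometric_realization (quiver_nerve C)) (r j)"
      if "j \<in> {..?N}" for j
    proof -
      let ?K = "subtopology (simplex_space n) (T j)"
      have hj: "continuous_map ?K euclideanreal (height n F)"
        by (rule continuous_map_from_subtopology[OF h])
      have "continuous_map ?K (powertop_real UNIV) (\<lambda>t. edge_point (height n F t - real j))"
        unfolding edge_point_def continuous_map_componentwise_UNIV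
        by (intro allI continuous_intros hj) auto
      moreover have "edge_point (height n F t - real j) \<in> standard_simplex 1" if "t \<in> T j" for t
        using that by (intro edge_point_in_standard_simplex) (auto simp: T_def)
      ultimately have "continuous_map ?K (simplex_space 1) (\<lambda>t. edge_point (height n F t - real j))"
        by (intro continuous_map_into_subtopology) (auto simp only: Pi_iff topspace_subtopology)
      from continuous_map_compose[OF this continuous_map_realization_point[OF E[of j]]]
      show ?thesis
        by (simp add: o_def r_def[abs_def])
    qed
    show "r i t = r j t" if "i \<in> {..?N}" "j \<in> {..?N}" "t \<in> topspace (simplex_space n) \<inter> T i \<inter> T j" for i j t
    proof (cases "i \<le> j")
      case True
      then show ?thesis
        using that by (intro agree) auto
    next
      case False
      then show ?thesis
        using that by (intro agree[symmetric]) auto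
    qed
    show "\<exists>j. j \<in> {..?N} \<and> t \<in> T j \<and> spine_retract n F t = r j t"
      if "t \<in> topspace (simplex_space n)" for t
    proof (intro exI conjI)
      have t: "t \<in> standard_simplex n"
        using that by simp
      note b = height_bounds[OF F t]
      then have j: "real (nat \<lfloor>height n F t\<rfloor>) = of_int \<lfloor>height n F t\<rfloor>"
        by simp
      show "nat \<lfloor>height n F t\<rfloor> \<in> {..?N}"
        using b by (simp add: nat_le_iff floor_le_iff)
      show "t \<in> T (nat \<lfloor>height n F t\<rfloor>)"
        unfolding T_def using t j floor_correct[of "height n F t"] by auto
      show "spine_retract n F t = r (nat \<lfloor>height n F t\<rfloor>) t"
        unfolding spine_retract_def r_def E_def j frac_def ..
    qed
  qed simp
qed

text \<open>At time 1 only the spine point remains; by \<open>spine_point_edge\<close> and one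
  gluing relation in the nerve it is the chosen point of the edge.\<close>

lemma realization_inclusion_spine_retract:
  assumes F: "F \<in> simplices (nerve C) n" and t: "t \<in> standard_simplex n"
  shows "realization_inclusion (nerve C) (spine_retract n F t) = deform 1 n F t"
proof -
  let ?f = "snd F (0, n)"
  have f: "?f \<in> Mor C"
    using nerve_simplexD(1)[OF F] by simp
  have e: "edge_point (frac (height n F t)) \<in> standard_simplex 1"
    using frac_lt_1[of "height n F t"] by (intro edge_point_in_standard_simplex) auto
  show ?thesis
    unfolding spine_retract_def deform_def slide_def
      realization_inclusion_point[OF simplicial_subset_quiver_nerve edge_in_quiver_nerve[OF f] e]
      nerve.realization_point_act[OF edge_map_monotone full_simplex_in[OF f] e]
      spine_point_edge[OF height_bounds[OF F t], symmetric]
    by simp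
qed

section \<open>The deformation at time 0 and on the subset\<close>

lemma deform_0:
  assumes "F \<in> simplices (nerve C) n" "t \<in> standard_simplex n"
  shows "deform 0 n F t = realization_point (nerve C) n F t"
  using realization_point_coords[OF assms] by (simp add: deform_def slide_def)

lemma spine_point_height:
  assumes "F \<in> simplices (quiver_nerve C) n" "t \<in> standard_simplex n"
  shows "spine_point (height n F t) = coords n F t"
  using assms coords_in_standard_simplex spine_point_mean
  by (simp add: height_def mem_quiver_nerve)

text \<open>Both ends of the segment coincide by \<open>spine_point_height\<close>, so the motion
  along it is trivial.\<close>

lemma deform_quiver_nerve:
  assumes "F \<in> simplices (quiver_nerve C) n" "t \<in> standard_simplex n"
  shows "deform s n F t = realization_point (nerve C) n F t"
  using deform_0[of F n t] assms spine_point_height[OF assms]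
  by (simp add: deform_def slide_def mem_quiver_nerve algebra_simps)

text \<open>Here the full simplex itself lies in the subset, so the gluing relations for the edge
  and for \<open>position n F\<close> hold already in the realization of the subset.\<close>

lemma spine_retract_quiver_nerve:
  assumes F: "F \<in> simplices (quiver_nerve C) n" and t: "t \<in> standard_simplex n"
  shows "spine_retract n F t = realization_point (quiver_nerve C) n F t"
proof -
  let ?f = "snd F (0, n)"
  have F': "F \<in> simplices (nerve C) n" and N: "len C ?f \<le> 1"
    using F by (simp_all add: mem_quiver_nerve)
  have f: "?f \<in> Mor C"
    using nerve_simplexD(1)[OF F'] by simp
  have G: "full_simplex C ?f \<in> simplices (quiver_nerve C) (len C ?f)"
    using full_simplex_in[OF f] factors_full_simplex[OF f, of 0 "len C ?f"] N
    by (simp add: mem_quiver_nerve)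
  have e: "edge_point (frac (height n F t)) \<in> standard_simplex 1"
    using frac_lt_1[of "height n F t"] by (intro edge_point_in_standard_simplex) auto
  have "spine_retract n F t =
      realization_point (quiver_nerve C) (len C ?f) (full_simplex C ?f) (spine_point (height n F t))"
    unfolding spine_retract_def spine_point_edge[OF height_bounds[OF F' t]]
    using quiver_nerve.realization_point_act[OF edge_map_monotone G e] by simp
  also have "\<dots> = realization_point (quiver_nerve C) n F t"
    unfolding spine_point_height[OF F t]
    using quiver_nerve.realization_point_act[OF position_monotone[OF F'] G t] act_position[OF F']
    by (simp add: coords_def)
  finally show ?thesis .
qed

end

section \<open>The retraction and the homotopy on the realizations\<close>

theorem theoremC:
  fixes C :: "('o, 'm) category"
  assumes "unique_factorization_category C"
  shows "\<exists>Y. simplicial_subset Y (nerve C) \<and>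
    (\<forall>n>1. \<forall>y\<in>simplices Y n. degenerate Y n y) \<and>
    embedding_map (geometric_realization Y) (geometric_realization (nerve C))
      (realization_inclusion (nerve C)) \<and>
    realization_inclusion (nerve C) ` topspace (geometric_realization Y)
      deformation_retract_of_space geometric_realization (nerve C)"
proof (intro exI conjI allI impI ballI)
  interpret unique_factorization_category C
    by fact
  let ?Y = "geometric_realization (quiver_nerve C)" and ?X = "geometric_realization (nerve C)"
  let ?\<iota> = "realization_inclusion (nerve C)"
  note sub = simplicial_subset_quiver_nerve
  show "simplicial_subset (quiver_nerve C) (nerve C)"
    by (rule sub)
  show "degenerate (quiver_nerve C) n y" if "1 < n" "y \<in> simplices (quiver_nerve C) n" for n y
    using that by (intro degenerate_quiver_nerve)
  \<comment> \<open>The retraction takes values in the realization of the subset itself and not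
    merely in its image, which makes it a left inverse of the inclusion.\<close>
  obtain R where R: "continuous_map ?X ?Y R"
    "\<And>n F t. \<lbrakk>F \<in> simplices (nerve C) n; t \<in> standard_simplex n\<rbrakk> \<Longrightarrow>
      R (realization_point (nerve C) n F t) = spine_retract n F t"
  proof (rule nerve.realization_lift[OF continuous_map_spine_retract spine_retract_act])
    fix g
    assume "continuous_map ?X ?Y g"
      "\<And>n F t. \<lbrakk>F \<in> simplices (nerve C) n; t \<in> standard_simplex n\<rbrakk> \<Longrightarrow>
        g (realization_point (nerve C) n F t) = spine_retract n F t"
    then show thesis
      by (rule that)
  qed
  obtain H where H: "continuous_map (prod_topology (top_of_set {0..1}) ?X) ?X H"
    "\<And>s n F t. \<lbrakk>s \<in> topspace (top_of_set {0..1}); F \<in> simplices (nerve C) n; t \<in> standard_simplex n\<rbrakk> \<Longrightarrow>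
      H (s, realization_point (nerve C) n F t) = deform s n F t"
  proof (rule nerve.realization_lift_prod[OF _ _ continuous_map_deform])
    show "locally_compact_space (top_of_set {0..1::real})"
      by (intro compact_imp_locally_compact_space) (simp add: compact_space_subtopology)
    show "Hausdorff_space (top_of_set {0..1::real})"
      by (simp add: Hausdorff_space_subtopology)
    show "deform s m (act (nerve C) m n \<theta> F) t = deform s n F (simplex_push m \<theta> t)"
      if "s \<in> topspace (top_of_set {0..1})" "\<theta> \<in> monotone_maps m n" "F \<in> simplices (nerve C) n"
        "t \<in> standard_simplex m" for s m n \<theta> F t
      using that by (intro deform_act) auto
    fix g
    assume "continuous_map (prod_topology (top_of_set {0..1}) ?X) ?X g"
      "\<And>s n F t. \<lbrakk>s \<in> topspace (top_of_set {0..1}); F \<in> simplices (nerve C) n; t \<in> standard_simplex n\<rbrakk> \<Longrightarrow>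
        g (s, realization_point (nerve C) n F t) = deform s n F t"
    then show thesis
      by (rule that)
  qed
  have \<iota>: "continuous_map ?Y ?X ?\<iota>"
    by (rule continuous_map_realization_inclusion[OF sub simplicial_set_nerve])
  have R\<iota>: "R (?\<iota> q) = q" and H\<iota>: "s \<in> {0..1} \<Longrightarrow> H (s, ?\<iota> q) = ?\<iota> q"
    if q: "q \<in> topspace ?Y" for s q
  proof -
    obtain n F t where q: "q = realization_point (quiver_nerve C) n F t"
      and F: "F \<in> simplices (quiver_nerve C) n" and t: "t \<in> standard_simplex n"
      using q by (auto simp: topspace_geometric_realization)
    have F': "F \<in> simplices (nerve C) n"
      using F by (simp add: mem_quiver_nerve)
    have \<iota>q: "?\<iota> (realization_point (quiver_nerve C) n F t) = realization_point (nerve C) n F t"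
      by (rule realization_inclusion_point[OF sub F t])
    show "R (?\<iota> q) = q"
      unfolding q \<iota>q R(2)[OF F' t] by (rule spine_retract_quiver_nerve[OF F t])
    show "H (s, ?\<iota> q) = ?\<iota> q" if "s \<in> {0..1}"
      unfolding q \<iota>q using H(2)[OF _ F' t, of s] deform_quiver_nerve[OF F t] that by simp
  qed
  have \<iota>R: "?\<iota> (R p) = H (1, p)" and H0: "H (0, p) = p" if p: "p \<in> topspace ?X" for p
  proof -
    obtain n F t where p: "p = realization_point (nerve C) n F t"
      and F: "F \<in> simplices (nerve C) n" and t: "t \<in> standard_simplex n"
      using p by (auto simp: topspace_geometric_realization)
    show "?\<iota> (R p) = H (1, p)" "H (0, p) = p"
      unfolding p R(2)[OF F t] realization_inclusion_spine_retract[OF F t]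
      using H(2)[OF _ F t] deform_0[OF F t] by simp_all
  qed
  show "embedding_map ?Y ?X ?\<iota>"
  \<comment> \<open>A continuous map with a continuous left inverse, here \<open>R\<close>, is an
    embedding.\<close>
  proof (rule section_imp_embedding_map)
    show "section_map ?Y ?X ?\<iota>"
      unfolding section_map_def retraction_maps_def using \<iota> R(1) R\<iota> by (intro exI[of _ R]) simp
  qed
  show "?\<iota> ` topspace ?Y deformation_retract_of_space ?X"
    unfolding deformation_retract_of_space_def
  proof (intro conjI exI)
    show sub_X: "?\<iota> ` topspace ?Y \<subseteq> topspace ?X"
      using \<iota> by (rule continuous_map_image_subset_topspace)
    show "continuous_map ?X (subtopology ?X (?\<iota> ` topspace ?Y)) (?\<iota> \<circ> R)"
      using continuous_map_funspace[OF R(1)]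
      by (intro continuous_map_into_subtopology continuous_map_compose[OF R(1) \<iota>]) (simp add: Pi_iff)
    show "\<forall>x\<in>?\<iota> ` topspace ?Y. (?\<iota> \<circ> R) x = x"
      by (simp add: R\<iota>)
    show "homotopic_with (\<lambda>h. \<forall>x\<in>?\<iota> ` topspace ?Y. h x = x) ?X ?X id (?\<iota> \<circ> R)"
    proof (subst homotopic_with)
      \<comment> \<open>The side condition of the homotopy must depend only on values on the space;
        it does, since the image of the subset lies there.\<close>
      show "(\<forall>x\<in>?\<iota> ` topspace ?Y. h x = x) \<longleftrightarrow> (\<forall>x\<in>?\<iota> ` topspace ?Y. k x = x)"
        if "\<And>x. x \<in> topspace ?X \<Longrightarrow> h x = k x" for h k
        using that sub_X by (intro ball_cong) (simp_all add: subset_iff)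
      show "\<exists>h. continuous_map (prod_topology (top_of_set {0..1::real}) ?X) ?X h \<and>
          (\<forall>x\<in>topspace ?X. h (0, x) = id x) \<and> (\<forall>x\<in>topspace ?X. h (1, x) = (?\<iota> \<circ> R) x) \<and>
          (\<forall>t\<in>{0..1}. \<forall>x\<in>?\<iota> ` topspace ?Y. h (t, x) = x)"
      proof (intro exI conjI)
        show "continuous_map (prod_topology (top_of_set {0..1}) ?X) ?X H"
          by (rule H(1))
      qed (auto simp: H0 \<iota>R H\<iota>)
    qed
  qed
qed

end
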